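(* Let $\nu\ge 0$, $T>0$, $\Omega=\mathbb{S}^1\times(-\infty,0)$ and $\Gamma=\mathbb{S}^1\times\{0\}$. Let $h^{(0)},h^{(1)}:\mathbb{S}^1\times[0,T]\to\mathbb{R}$ be smooth functions and let $\varphi^{(0)},\varphi^{(1)}:\overline{\Omega}\times[0,T]\to\mathbb{R}$ be smooth functions such that, for every $t\in[0,T]$, $\varphi^{(0)}(x_1,x_2,t)\to 0$ and $\varphi^{(1)}(x_1,x_2,t)\to 0$ as $x_2\to-\infty$, uniformly in $x_1$. Suppose that they satisfy $$\Delta \varphi^{(0)} = 0 \ \text{ in } \Omega\times[0,T],\qquad \partial_2\varphi^{(0)}=\partial_1\big(h^{(0)}-\nu\,\partial_1^2h^{(0)}\big)\ \text{ on } \Gamma\times[0,T],\qquad \partial_t h^{(0)}=\partial_1\varphi^{(0)}\ \text{ on } \Gamma\times[0,T],$$ and $$\Delta \varphi^{(1)} = \partial_1^2h^{(0)}\,\partial_2\varphi^{(0)}+2\,\partial_1h^{(0)}\,\partial_1\partial_2\varphi^{(0)} \ \text{ in } \Omega\times[0,T],$$ $$\partial_2\varphi^{(1)}=\partial_1\big(h^{(1)}-\nu\,\partial_1^2h^{(1)}\big)+\partial_1h^{(0)}\,\partial_1\varphi^{(0)}\ \text{ on } \Gamma\times[0,T],\qquad \partial_t h^{(1)}=\partial_1\varphi^{(1)}\ \text{ on } \Gamma\times[0,T].$$ Then on $\mathbb{S}^1\times[0,T]$ $$\partial_t h^{(0)}=-\nu\Lambda^3h^{(0)}-\Lambda h^{(0)},$$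 $$\partial_t h^{(1)}=-\nu\Lambda^3h^{(1)}-\Lambda h^{(1)}+\partial_1\Big([h^{(0)},\mathcal{H}]\big(-\nu\Lambda^3h^{(0)}-\Lambda h^{(0)}\big)\Big).$$ Consequently, for $\sigma>0$ the function $f=h^{(0)}+\sigma h^{(1)}$ satisfies $$\partial_t f=-\nu\Lambda^3f-\Lambda f+\sigma\,\partial_1\Big([f,\mathcal{H}]\big(-\nu\Lambda^3f-\Lambda f\big)\Big)+\mathcal{O}(\sigma^2)\qquad\text{as }\sigma\to0^+,$$ where $h^{(0)},h^{(1)}$ do not depend on $\sigma$ and $\mathcal{O}(\sigma^2)$ is uniform on $\mathbb{S}^1\times[0,T]$.
   Context: $\mathbb{S}^1$ is the circle identified with $[-\pi,\pi]$ with periodic boundary conditions; points of $\Omega$ are written $(x_1,x_2)$, $\partial_j=\partial/\partial x_j$, $\Delta=\partial_1^2+\partial_2^2$. For a function $f$ on $\mathbb{S}^1$, $\hat f(k)=\frac1{2\pi}\int_{\mathbb{S}^1}f(x_1)e^{-ikx_1}\,dx_1$, $k\in\mathbb{Z}$. The Hilbert transform $\mathcal{H}$ and the Calderon operator $\Lambda$ act in the $x_1$ variable and are defined by $\widehat{\mathcal{H}f}(k)=-i\,\mathrm{sgn}(k)\hat f(k)$ (with $\mathrm{sgn}(0)=0$) and $\widehat{\Lambda f}(k)=|k|\hat f(k)$. The commutator is $[h,\mathcal{H}]g=h\,\mathcal{H}g-\mathcal{H}(hg)$. Functions $h^{(n)}(x_1,t)$ are regarded as functions on $\overline\Omega\times[0,T]$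 independent of $x_2$; on $\Gamma$ the functions $\varphi^{(n)}$ and their derivatives are evaluated at $x_2=0$. The two systems are those satisfied by the first two coefficients of the expansions $h=\sum_n\sigma^nh^{(n)}$, $\varphi=\sum_n\sigma^n\varphi^{(n)}$ in the steepness parameter $\sigma$ for the dimensionless two-dimensional infinitely deep one-phase Muskat (free boundary Darcy) problem in stream function form pulled back to $\Omega$; $\nu$ is the (nonnegative) Bond number. *)

theory Defs
  imports "HOL-Analysis.Analysis"
begin

text \<open>
  Functions on the circle are represented by \<open>2\<pi>\<close>-periodic functions on the real line;
  functions on the closed half cylinder (times a time interval) are written
  \<open>\<phi> x1 x2 t\<close> and are only constrained for \<open>x2 \<le> 0\<close> and \<open>t \<in> [0,T]\<close>.
\<close>

definition periodic :: "(real \<Rightarrow> real) \<Rightarrow> bool"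
  where "periodic f \<longleftrightarrow> (\<forall>x. f (x + 2 * pi) = f x)"

text \<open>
  Differentiability up to the boundary: derivatives are taken within \<open>S\<close>. They are unique for the
  sets used below, which are closed, convex and have nonempty interior.
\<close>

primrec Ck_on ::
  "nat \<Rightarrow> 'a::real_normed_vector set \<Rightarrow> ('a \<Rightarrow> 'b::real_normed_vector) \<Rightarrow> bool"
where
  "Ck_on 0 S f \<longleftrightarrow> continuous_on S f"
| "Ck_on (Suc n) S f \<longleftrightarrow>
     (\<exists>f'. (\<forall>x\<in>S. (f has_derivative f' x) (at x within S)) \<and> (\<forall>v. Ck_on n S (\<lambda>x. f' x v)))"

definition smooth_on :: "'a::real_normed_vector set \<Rightarrow> ('a \<Rightarrow> 'b::real_normed_vector) \<Rightarrow> bool"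
  where "smooth_on S f \<longleftrightarrow> (\<forall>n. Ck_on n S f)"

definition smooth_circle :: "real \<Rightarrow> (real \<Rightarrow> real \<Rightarrow> real) \<Rightarrow> bool"
  where "smooth_circle T h \<longleftrightarrow>
    (\<forall>t\<in>{0..T}. periodic (\<lambda>x. h x t)) \<and>
    smooth_on (UNIV \<times> {0..T}) (\<lambda>(x, t). h x t)"

definition smooth_cylinder :: "real \<Rightarrow> (real \<Rightarrow> real \<Rightarrow> real \<Rightarrow> real) \<Rightarrow> bool"
  where "smooth_cylinder T \<phi> \<longleftrightarrow>
    (\<forall>x2\<le>0. \<forall>t\<in>{0..T}. periodic (\<lambda>x1. \<phi> x1 x2 t)) \<and>
    smooth_on (UNIV \<times> {..0} \<times> {0..T}) (\<lambda>(x1, x2, t). \<phi> x1 x2 t)"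

text \<open>Derivatives of functions on the circle; time derivatives are one-sided at \<open>0\<close> and \<open>T\<close>.\<close>

definition dx :: "(real \<Rightarrow> real \<Rightarrow> real) \<Rightarrow> real \<Rightarrow> real \<Rightarrow> real"
  where "dx h x t = deriv (\<lambda>y. h y t) x"

definition dt :: "real \<Rightarrow> (real \<Rightarrow> real \<Rightarrow> real) \<Rightarrow> real \<Rightarrow> real \<Rightarrow> real"
  where "dt T h x t = vector_derivative (\<lambda>s. h x s) (at t within {0..T})"

text \<open>Derivatives on the half cylinder; the \<open>x2\<close>-derivative is one-sided at \<open>x2 = 0\<close>.\<close>

definition D1 :: "(real \<Rightarrow> real \<Rightarrow> real \<Rightarrow> real) \<Rightarrow> real \<Rightarrow> real \<Rightarrow> real \<Rightarrow> real"
  where "D1 \<phi> x1 x2 t = deriv (\<lambda>y. \<phi> y x2 t) x1"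

definition D2 :: "(real \<Rightarrow> real \<Rightarrow> real \<Rightarrow> real) \<Rightarrow> real \<Rightarrow> real \<Rightarrow> real \<Rightarrow> real"
  where "D2 \<phi> x1 x2 t = vector_derivative (\<lambda>y. \<phi> x1 y t) (at x2 within {..0})"

definition laplacian :: "(real \<Rightarrow> real \<Rightarrow> real \<Rightarrow> real) \<Rightarrow> real \<Rightarrow> real \<Rightarrow> real \<Rightarrow> real"
  where "laplacian \<phi> x1 x2 t = D1 (D1 \<phi>) x1 x2 t + D2 (D2 \<phi>) x1 x2 t"

definition decays :: "real \<Rightarrow> (real \<Rightarrow> real \<Rightarrow> real \<Rightarrow> real) \<Rightarrow> bool"
  where "decays T \<phi> \<longleftrightarrow>
    (\<forall>t\<in>{0..T}. uniform_limit UNIV (\<lambda>x2 x1. \<phi> x1 x2 t) (\<lambda>x1. 0) at_bot)"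

definition fourier_coeff :: "(real \<Rightarrow> real) \<Rightarrow> int \<Rightarrow> complex"
  where "fourier_coeff f k =
    1 / (2 * of_real pi) *
    integral {-pi..pi} (\<lambda>x. of_real (f x) * exp (- \<i> * of_int k * of_real x))"

text \<open>
  The operator with symbol \<open>m\<close>, characterised by the Fourier coefficients of its values. A continuous
  periodic function is determined by its Fourier coefficients, so there is at most one such \<open>g\<close>;
  for smooth periodic \<open>f\<close> and the symbols below it exists (and is again smooth and real-valued).
\<close>

definition fourier_multiplier :: "(int \<Rightarrow> complex) \<Rightarrow> (real \<Rightarrow> real) \<Rightarrow> real \<Rightarrow> real"
  where "fourier_multiplier m f =
    (THE g. continuous_on UNIV g \<and> periodic g \<and>
            (\<forall>k. fourier_coeff g k = m k * fourier_coeff f k))"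

definition hilbert :: "(real \<Rightarrow> real) \<Rightarrow> real \<Rightarrow> real"
  where "hilbert = fourier_multiplier (\<lambda>k. - \<i> * of_int (sgn k))"

definition calderon :: "(real \<Rightarrow> real) \<Rightarrow> real \<Rightarrow> real"
  where "calderon = fourier_multiplier (\<lambda>k. of_int \<bar>k\<bar>)"

definition hilbert_commutator :: "(real \<Rightarrow> real) \<Rightarrow> (real \<Rightarrow> real) \<Rightarrow> real \<Rightarrow> real"
  where "hilbert_commutator h g x = h x * hilbert g x - hilbert (\<lambda>y. h y * g y) x"

text \<open>The linear operator \<open>- \<nu> \<Lambda>\<^sup>3 - \<Lambda>\<close>, and the nonlinearity
  \<open>\<partial>\<^sub>1 ([u, H] (- \<nu> \<Lambda>\<^sup>3 u - \<Lambda> u))\<close>.\<close>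

definition lin_op :: "real \<Rightarrow> (real \<Rightarrow> real) \<Rightarrow> real \<Rightarrow> real"
  where "lin_op \<nu> u x = - \<nu> * (calderon ^^ 3) u x - calderon u x"

definition quad_op :: "real \<Rightarrow> (real \<Rightarrow> real) \<Rightarrow> real \<Rightarrow> real"
  where "quad_op \<nu> u x = deriv (hilbert_commutator u (lin_op \<nu> u)) x"

end

theory Submission
  imports Defs
begin

text \<open>
  Write \<open>g = \<partial>\<^sub>1(h - \<nu> \<partial>\<^sub>1\<^sup>2 h)\<close>; since \<open>\<Lambda> = H \<partial>\<^sub>1\<close>, the linear operator is \<open>- H g\<close>. A decaying
  harmonic function on the half cylinder satisfies \<open>\<partial>\<^sub>2 \<psi> = \<Lambda> \<psi>\<close> on the boundary, mode by mode,
  hence \<open>\<partial>\<^sub>1 \<psi> = - H \<partial>\<^sub>2 \<psi>\<close> there; this gives the equation for \<open>h0\<close>, and \<open>H \<partial>\<^sub>t h0 = \<partial>\<^sub>2 \<phi>0\<close>.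
  At the next order the source is an exact Laplacian: \<open>\<psi> = \<phi>1 - h0 \<partial>\<^sub>2 \<phi>0\<close> is harmonic, and its
  normal derivative on the boundary is \<open>g1 + \<partial>\<^sub>1(h0 \<partial>\<^sub>t h0)\<close>, so
  \<open>\<partial>\<^sub>1 \<phi>1 = \<partial>\<^sub>1(h0 H \<partial>\<^sub>t h0) - H g1 - H \<partial>\<^sub>1(h0 \<partial>\<^sub>t h0)\<close>, which is the asserted commutator form. The
  commutator nonlinearity is bilinear, so for \<open>h0 + \<sigma> h1\<close> the residual is \<open>\<sigma>\<^sup>2\<close> times terms that are
  bounded uniformly in space and time.
\<close>

section \<open>Fourier coefficients\<close>

text \<open>Two obstacles shape the development. The potentials decay, but nothing is assumed about
  their derivatives; and \<open>hilbert\<close> is a definite description, so each of its values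
  must be identified before it can be used. Testing against \<open>exp (- \<i> k x1)\<close> meets
  both: an equality of continuous periodic functions becomes an equality of coefficients, and the
  boundary value problems become ordinary differential equations on a half line. The harmonicity of
  \<open>\<phi>1 - h0 \<partial>\<^sub>2 \<phi>0\<close> is used only in this tested form.
  Derivatives in \<open>x1\<close> are moved onto \<open>h0\<close> and the exponential, so mixed
  derivatives are never interchanged and no third derivatives of the potentials occur. The error
  must be uniform in time. Periodic functions are therefore handled as families indexed by
  \<open>t\<close> with common bounds on all \<open>x1\<close>-derivatives, and the Hilbert
  transform is constructed together with a sup bound in terms of second derivatives.\<close>

lemma fourier_integrable:
  assumes "continuous_on {-pi..pi} f"
  shows "(\<lambda>x. complex_of_real (f x) * exp (- \<i> * of_int k * of_real x)) integrable_on {-pi..pi}"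
  by (intro integrable_continuous_real continuous_intros assms)

lemma fourier_coeff_add:
  assumes "continuous_on {-pi..pi} f" "continuous_on {-pi..pi} g"
  shows "fourier_coeff (\<lambda>x. f x + g x) k = fourier_coeff f k + fourier_coeff g k"
  using integral_add[OF assms[THEN fourier_integrable, of k]]
  by (simp add: fourier_coeff_def algebra_simps)

lemma fourier_coeff_cmult: "fourier_coeff (\<lambda>x. c * f x) k = of_real c * fourier_coeff f k"
  using integral_mult_right[of "{-pi..pi}" "complex_of_real c" 
      "\<lambda>x. complex_of_real (f x) * exp (- \<i> * of_int k * of_real x)"]
  by (simp add: fourier_coeff_def mult.assoc)

lemma fourier_coeff_minus: "fourier_coeff (\<lambda>x. - f x) k = - fourier_coeff f k"
  using fourier_coeff_cmult[of "-1" f k] by simp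

lemma fourier_coeff_diff:
  assumes "continuous_on {-pi..pi} f" "continuous_on {-pi..pi} g"
  shows "fourier_coeff (\<lambda>x. f x - g x) k = fourier_coeff f k - fourier_coeff g k"
  using fourier_coeff_add[OF assms(1) continuous_on_minus[OF assms(2)], of k]
  by (simp add: fourier_coeff_minus)

lemma norm_fourier_coeff_le:
  assumes "continuous_on {-pi..pi} f" "\<And>x. x \<in> {-pi..pi} \<Longrightarrow> \<bar>f x\<bar> \<le> M"
  shows "norm (fourier_coeff f k) \<le> M"
proof -
  have "norm (integral {-pi..pi} (\<lambda>x. complex_of_real (f x) * exp (- \<i> * of_int k * of_real x)))
      \<le> M * (pi - (-pi))"
    by (rule integral_bound)
       (use assms in \<open>auto simp: norm_mult norm_exp_eq_Re intro!: continuous_intros\<close>)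
  then show ?thesis
    by (simp add: fourier_coeff_def norm_mult norm_divide field_simps)
qed

text \<open>Holds because \<open>f\<close> is real-valued. It recovers the negative frequencies from
  the positive ones in the Hilbert series, and shows that the mean is real.\<close>

lemma fourier_coeff_uminus: "fourier_coeff f (- k) = cnj (fourier_coeff f k)"
proof -
  have "integral {-pi..pi} (\<lambda>x. complex_of_real (f x) * exp (- \<i> * of_int (-k) * of_real x))
      = integral {-pi..pi} (\<lambda>x. cnj (complex_of_real (f x) * exp (- \<i> * of_int k * of_real x)))"
    by (simp add: exp_cnj)
  also have "\<dots> = cnj (integral {-pi..pi} (\<lambda>x. complex_of_real (f x) * exp (- \<i> * of_int k * of_real x)))"
    by (rule integral_cnj[symmetric])
  finally show ?thesis
    by (simp add: fourier_coeff_def)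
qed

lemma exp_int_pi_eq: "exp (- \<i> * of_int k * of_real pi) = exp (- \<i> * of_int k * of_real (- pi))"
proof -
  have "exp (- \<i> * of_int k * of_real (- pi)) =
      exp (- \<i> * of_int k * of_real pi + 2 * of_int k * of_real pi * \<i>)"
    by (simp add: algebra_simps)
  also have "\<dots> = exp (- \<i> * of_int k * of_real pi)"
    using exp_plus_2pin[of "- \<i> * of_int k * of_real pi" k] by (simp add: algebra_simps)
  finally show ?thesis by simp
qed

lemma periodic_pi: "periodic f \<Longrightarrow> f pi = f (- pi)"
  unfolding periodic_def by (drule spec[of _ "-pi"]) simp

text \<open>Integration by parts over one period; the boundary terms cancel because \<open>f\<close>
  and the exponential take equal values at both ends.\<close>

lemma fourier_coeff_deriv:
  assumes per: "periodic f"
    and der: "\<And>x. (f has_real_derivative f' x) (at x)"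
    and cont: "continuous_on {-pi..pi} f'"
  shows "fourier_coeff f' k = \<i> * of_int k * fourier_coeff f k"
proof -
  let ?e = "\<lambda>x. exp (- \<i> * of_int k * complex_of_real x)"
  have contf: "continuous_on {-pi..pi} f"
    by (meson der DERIV_continuous_on has_field_derivative_at_within)
  have e: "(?e has_vector_derivative (- \<i> * of_int k * ?e x)) (at x within S)" for x S
    by (rule has_vector_derivative_real_field) (auto intro!: derivative_eq_intros)
  have f: "((\<lambda>x. complex_of_real (f x)) has_vector_derivative of_real (f' x)) (at x within S)" for x S
    using der[of x] 
    by (intro has_vector_derivative_of_real)
       (simp add: has_field_derivative_at_within flip: has_real_derivative_iff_has_vector_derivative)
  have "((\<lambda>x. of_real (f x) * (- \<i> * of_int k * ?e x) + of_real (f' x) * ?e x) has_integral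
      (of_real (f pi) * ?e pi - of_real (f (-pi)) * ?e (-pi))) {-pi..pi}"
    by (rule fundamental_theorem_of_calculus) (simp, intro has_vector_derivative_mult f e)
  also have "of_real (f pi) * ?e pi - of_real (f (-pi)) * ?e (-pi) = 0"
    using exp_int_pi_eq[of k] periodic_pi[OF per] by simp
  finally have "integral {-pi..pi} (\<lambda>x. - \<i> * of_int k * (of_real (f x) * ?e x) + of_real (f' x) * ?e x) = 0"
    by (auto simp: algebra_simps intro: integral_unique)
  also have "integral {-pi..pi} (\<lambda>x. - \<i> * of_int k * (of_real (f x) * ?e x) + of_real (f' x) * ?e x) = 
     - \<i> * of_int k * integral {-pi..pi} (\<lambda>x. of_real (f x) * ?e x) + integral {-pi..pi} (\<lambda>x. of_real (f' x) * ?e x)"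
    by (subst integral_add[OF integrable_on_mult_right[OF fourier_integrable[OF contf]] fourier_integrable[OF cont]])
       (simp only: integral_mult_right)
  finally show ?thesis
    by (simp add: fourier_coeff_def field_simps)
qed

section \<open>Limits and parameter derivatives of Fourier coefficients\<close>

lemma fourier_coeff_tendsto:
  assumes "uniform_limit {-pi..pi} F f net" "\<forall>\<^sub>F n in net. continuous_on {-pi..pi} (F n)"
    and "continuous_on {-pi..pi} f"
  shows "((\<lambda>n. fourier_coeff (F n) k) \<longlongrightarrow> fourier_coeff f k) net"
proof (rule tendstoI)
  fix e :: real assume "e > 0"
  then have "\<forall>\<^sub>F n in net. \<forall>x\<in>{-pi..pi}. dist (F n x) (f x) < e/2"
    using assms(1) half_gt_zero unfolding uniform_limit_iff by blast
  with assms(2) show "\<forall>\<^sub>F n in net. dist (fourier_coeff (F n) k) (fourier_coeff f k) < e"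
  proof eventually_elim
    case (elim n)
    \<comment> \<open>The coefficient bound is not strict, so half of \<open>e\<close> is used to
      end strictly below \<open>e\<close>.\<close>
    have "norm (fourier_coeff (\<lambda>x. F n x - f x) k) \<le> e/2"
      using elim assms(3)
      by (intro norm_fourier_coeff_le) (auto intro!: continuous_intros simp: dist_real_def less_imp_le)
    then show ?case
      using elim assms(3) \<open>e > 0\<close> by (simp add: fourier_coeff_diff dist_norm)
  qed
qed

text \<open>Differentiation under the integral within a convex \<open>U\<close>. With
  \<open>U = {..0}\<close> it turns a function on the half cylinder into modes depending on
  \<open>x2\<close>, with a one-sided derivative at the boundary.\<close>

lemma fourier_coeff_leibniz:
  assumes der: "\<And>x y. y \<in> U \<Longrightarrow> ((\<lambda>y. F x y) has_real_derivative F' x y) (at y within U)"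
    and contF: "\<And>y. y \<in> U \<Longrightarrow> continuous_on UNIV (\<lambda>x. F x y)"
    and cont: "continuous_on (UNIV \<times> U) (\<lambda>(x, y). F' x y)"
    and "convex U" "y \<in> U"
  shows "((\<lambda>y. fourier_coeff (\<lambda>x. F x y) k) has_vector_derivative fourier_coeff (\<lambda>x. F' x y) k) (at y within U)"
proof -
  let ?e = "\<lambda>x. exp (- \<i> * of_int k * complex_of_real x)"
  have cont': "continuous_on (U \<times> {-pi..pi}) (\<lambda>p. F' (snd p) (fst p))"
    using continuous_on_compose2[OF cont, of "U \<times> cbox (-pi) pi" "\<lambda>p. (snd p, fst p)"]
    using continuous_on_swap[of "U \<times> cbox (-pi) pi"] by (fastforce simp: prod.swap_def)
  have "((\<lambda>y. integral (cbox (-pi) pi) (\<lambda>x. of_real (F x y) * ?e x)) has_vector_derivative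
     integral (cbox (-pi) pi) (\<lambda>x. of_real (F' x y) * ?e x)) (at y within U)"
  proof (rule leibniz_rule_vector_derivative[OF _ _ _ assms(5,4)])
    fix x y assume "y \<in> U"
    show "((\<lambda>y. of_real (F x y) * ?e x) has_vector_derivative of_real (F' x y) * ?e x) (at y within U)"
      by (intro has_vector_derivative_mult_left has_vector_derivative_of_real)
         (use der[OF \<open>y \<in> U\<close>] in \<open>simp add: has_real_derivative_iff_has_vector_derivative\<close>)
  next
    fix y assume "y \<in> U"
    show "(\<lambda>x. of_real (F x y) * ?e x) integrable_on cbox (-pi) pi"
      using fourier_integrable[OF continuous_on_subset[OF contF[OF \<open>y \<in> U\<close>]]] by auto
  next
    show "continuous_on (U \<times> cbox (-pi) pi) (\<lambda>(y, x). of_real (F' x y) * ?e x)"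
      by (auto simp: case_prod_unfold intro!: continuous_intros cont')
  qed
  then show ?thesis
    unfolding fourier_coeff_def by (intro has_vector_derivative_mult_right) simp
qed

section \<open>Uniqueness of Fourier coefficients\<close>

lemma exp_shift_frequency:
  "exp (- \<i> * of_int (k - 1) * complex_of_real x) = exp (- \<i> * of_int k * of_real x) * exp (\<i> * of_real x)"
  "exp (- \<i> * of_int (k + 1) * complex_of_real x) = exp (- \<i> * of_int k * of_real x) * exp (- (\<i> * of_real x))"
  by (simp_all add: algebra_simps flip: exp_add)

lemma fourier_coeff_cos:
  assumes "continuous_on {-pi..pi} g"
  shows "fourier_coeff (\<lambda>x. g x * cos x) k = (fourier_coeff g (k - 1) + fourier_coeff g (k + 1)) / 2"
proof -
  let ?e = "\<lambda>k x. complex_of_real (g x) * exp (- \<i> * of_int k * of_real x)"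
  have alg: "a * ((p + n) / 2) * e = (a * (e * p) + a * (e * n)) / 2" for a p n e :: complex
    by (simp add: field_simps)
  have c: "complex_of_real (cos x) = (exp (\<i> * of_real x) + exp (- (\<i> * of_real x))) / 2" for x
    by (simp add: cos_exp_eq flip: cos_of_real)
  have "integral {-pi..pi} (\<lambda>x. complex_of_real (g x * cos x) * exp (- \<i> * of_int k * of_real x))
     = integral {-pi..pi} (\<lambda>x. (?e (k - 1) x + ?e (k + 1) x) / 2)"
    by (simp only: exp_shift_frequency of_real_mult c alg)
  also have "\<dots> = (integral {-pi..pi} (?e (k - 1)) + integral {-pi..pi} (?e (k + 1))) / 2"
    by (simp only: integral_divide integral_add fourier_integrable[OF assms])
  finally show ?thesis
    by (simp only: fourier_coeff_def distrib_left times_divide_eq_right)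
qed

lemma fourier_coeff_sin:
  assumes "continuous_on {-pi..pi} g"
  shows "fourier_coeff (\<lambda>x. g x * sin x) k = (fourier_coeff g (k - 1) - fourier_coeff g (k + 1)) / (2 * \<i>)"
proof -
  let ?e = "\<lambda>k x. complex_of_real (g x) * exp (- \<i> * of_int k * of_real x)"
  have alg: "a * ((p - n) / (2 * \<i>)) * e = (a * (e * p) - a * (e * n)) / (2 * \<i>)" for a p n e :: complex
    by (simp add: field_simps)
  have c: "complex_of_real (sin x) = (exp (\<i> * of_real x) - exp (- (\<i> * of_real x))) / (2 * \<i>)" for x
    by (simp add: sin_exp_eq flip: sin_of_real)
  have "integral {-pi..pi} (\<lambda>x. complex_of_real (g x * sin x) * exp (- \<i> * of_int k * of_real x))
     = integral {-pi..pi} (\<lambda>x. (?e (k - 1) x - ?e (k + 1) x) / (2 * \<i>))"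
    by (simp only: exp_shift_frequency of_real_mult c alg)
  also have "\<dots> = (integral {-pi..pi} (?e (k - 1)) - integral {-pi..pi} (?e (k + 1))) / (2 * \<i>)"
    by (simp only: integral_divide integral_diff fourier_integrable[OF assms])
  finally show ?thesis
    by (simp only: fourier_coeff_def right_diff_distrib times_divide_eq_right)
qed

text \<open>
  Quantifying over all \<open>g\<close> with vanishing coefficients makes the induction go through for products
  of polynomials.
\<close>

lemma polynomial_cis_fourier_coeff_zero:
  assumes "real_polynomial_function p"
    and "continuous_on {-pi..pi} g" "\<And>k. fourier_coeff g k = 0"
  shows "continuous_on {-pi..pi} (\<lambda>x. g x * p (cis x)) \<and> (\<forall>k. fourier_coeff (\<lambda>x. g x * p (cis x)) k = 0)"
  using assms
proof (induction p arbitrary: g)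
  case (linear p)
  interpret bounded_linear p by fact
  \<comment> \<open>A real-linear functional on the plane is fixed by its values at \<open>1\<close>
    and \<open>\<i>\<close>. On the unit circle it is a combination of cosine and sine, and these
    only shift frequencies by one.\<close>
  have p: "p (cis x) = p 1 * cos x + p \<i> * sin x" for x
  proof -
    have "p (cis x) = p (cos x *\<^sub>R 1 + sin x *\<^sub>R \<i>)"
      by (rule arg_cong[of _ _ p]) (simp add: complex_eq_iff)
    then show ?thesis by (simp only: add scale) simp
  qed
  have eq: "(\<lambda>x. g x * p (cis x)) = (\<lambda>x. p 1 * (g x * cos x) + p \<i> * (g x * sin x))"
    by (auto simp: p algebra_simps)
  show ?case
    unfolding eq using linear.prems
    by (simp add: fourier_coeff_add fourier_coeff_cmult fourier_coeff_cos fourier_coeff_sin continuous_intros)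
next
  case (const c)
  have eq: "(\<lambda>x. g x * c) = (\<lambda>x. c * g x)" by auto
  show ?case using const unfolding eq by (auto intro!: continuous_intros simp: fourier_coeff_cmult)
next
  case (add p q)
  have eq: "(\<lambda>x. g x * (p (cis x) + q (cis x))) = (\<lambda>x. g x * p (cis x) + g x * q (cis x))"
    by (auto simp: algebra_simps)
  show ?case 
    unfolding eq using add.IH[of g] add.prems by (auto intro!: continuous_on_add simp: fourier_coeff_add)
next
  case (mult p q)
  have eq: "(\<lambda>x. g x * (p (cis x) * q (cis x))) = (\<lambda>x. (g x * p (cis x)) * q (cis x))"
    by (auto simp: algebra_simps)
  have "continuous_on {-pi..pi} (\<lambda>x. g x * p (cis x))" "\<And>k. fourier_coeff (\<lambda>x. g x * p (cis x)) k = 0"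
    using mult.IH(1)[OF mult.prems] by auto
  from mult.IH(2)[OF this] show ?case unfolding eq .
qed

section \<open>Periodic functions as functions on the unit circle\<close>

lemma periodic_int: "periodic f \<Longrightarrow> f (x + 2 * pi * of_int k) = f x"
proof (induction k rule: int_induct[where k=0])
  case (step1 i)
  have "f (x + 2 * pi * of_int (i + 1)) = f (x + 2 * pi * of_int i + 2 * pi)"
    by (simp add: algebra_simps)
  also have "\<dots> = f (x + 2 * pi * of_int i)"
    using step1.prems unfolding periodic_def by blast
  finally show ?case using step1 by simp
next
  case (step2 i)
  have "f (x + 2 * pi * of_int (i - 1)) = f (x + 2 * pi * of_int (i - 1) + 2 * pi)"
    using step2.prems unfolding periodic_def by simp
  also have "x + 2 * pi * of_int (i - 1) + 2 * pi = x + 2 * pi * of_int i"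
    by (simp add: algebra_simps)
  finally show ?case using step2 by simp
qed simp

lemma periodic_reduce:
  assumes "periodic f"
  obtains y where "y \<in> {-pi..pi}" "f x = f y"
proof
  let ?k = "\<lfloor>(x + pi) / (2 * pi)\<rfloor>"
  have "of_int ?k \<le> (x + pi) / (2 * pi)" "(x + pi) / (2 * pi) < of_int ?k + 1"
    by linarith+
  then have "of_int ?k * (2 * pi) \<le> x + pi" "x + pi < (of_int ?k + 1) * (2 * pi)"
    by (simp_all only: pos_le_divide_eq pos_divide_less_eq pi_gt_zero mult_pos_pos zero_less_numeral)
  then show "x - 2 * pi * of_int ?k \<in> {-pi..pi}"
    by (auto simp: algebra_simps)
  from periodic_int[OF assms, of "x - 2 * pi * of_int ?k" "?k"]
  show "f x = f (x - 2 * pi * of_int ?k)" by simp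
qed

lemma periodic_cis_eq:
  assumes "periodic f" "cis x = cis y"
  shows "f x = f y"
proof -
  have "exp (\<i> * of_real x) = exp (\<i> * of_real y)"
    using assms(2) by (simp add: cis_conv_exp)
  then obtain n :: int where "\<i> * complex_of_real x = \<i> * of_real y + (of_int (2 * n) * pi) * \<i>"
    unfolding exp_eq by auto
  then have "complex_of_real x = complex_of_real (y + 2 * pi * of_int n)"
    by (simp add: algebra_simps complex_eq_iff)
  then have "x = y + 2 * pi * of_int n"
    by (simp only: of_real_eq_iff)
  then show ?thesis using periodic_int[OF assms(1)] by simp
qed

text \<open>\<open>Arg\<close> jumps across the negative real axis and \<open>Arg2pi\<close> across
  the positive one. The two angles differ by a multiple of \<open>2 * pi\<close>, which
  \<open>f\<close> does not see, and every point of the circle avoids one of the two cuts.\<close>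

lemma continuous_on_periodic_Arg:
  assumes "continuous_on UNIV f" "periodic f"
  shows "continuous_on (sphere 0 1) (\<lambda>z. f (Arg z))"
proof (rule continuous_at_imp_continuous_on, intro ballI)
  fix z :: complex assume z: "z \<in> sphere 0 1"
  have f: "continuous (at x) f" for x
    using assms(1) unfolding continuous_on_eq_continuous_at[OF open_UNIV] by blast
  show "continuous (at z) (\<lambda>z. f (Arg z))"
  proof (cases "z \<in> \<real>\<^sub>\<le>\<^sub>0")
    case False
    then show ?thesis
      by (rule isCont_o2[OF continuous_at_Arg f])
  next
    case True
    then have "z \<notin> \<real>\<^sub>\<ge>\<^sub>0"
      using z by (auto simp: complex_nonpos_Reals_iff complex_nonneg_Reals_iff cmod_def)
    then have "continuous (at z) (\<lambda>z. f (Arg2pi z))"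
      by (rule isCont_o2[OF continuous_at_Arg2pi f])
    moreover have "f (Arg z) = f (Arg2pi z)" if "z \<noteq> 0" for z
    proof (rule periodic_cis_eq[OF assms(2)])
      have "of_real (norm z) * cis (Arg z) = z"
        unfolding cis_conv_exp by (rule Arg_eq[OF that, symmetric])
      also have "z = of_real (norm z) * cis (Arg2pi z)"
        unfolding cis_conv_exp by (rule Arg2pi_eq)
      finally have "of_real (norm z) * cis (Arg z) = of_real (norm z) * cis (Arg2pi z)" .
      then show "cis (Arg z) = cis (Arg2pi z)"
        using that by simp
    qed
    then have "\<forall>\<^sub>F w in nhds z. f (Arg2pi w) = f (Arg w)"
      using z by (intro eventually_mono[OF t1_space_nhds[of z 0]]) auto
    ultimately show ?thesis
      using isCont_cong[of "\<lambda>z. f (Arg2pi z)" "\<lambda>z. f (Arg z)" z] by blast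
  qed
qed

text \<open>By Stone-Weierstrass \<open>f\<close> is uniformly close to a polynomial in
  \<open>cis x\<close>, and \<open>f\<close> is orthogonal to all of these. Hence the mean of
  \<open>f * f\<close> is arbitrarily small, so zero, and continuity gives
  \<open>f = 0\<close>.\<close>

lemma fourier_coeff_zero_imp_zero:
  assumes cont: "continuous_on UNIV f" and per: "periodic f" and zero: "\<And>k. fourier_coeff f k = 0"
  shows "f x = 0"
proof -
  have contf: "continuous_on {-pi..pi} f"
    using cont continuous_on_subset by blast
  have "bounded (f ` {-pi..pi})"
    by (intro compact_imp_bounded compact_continuous_image contf) auto
  then obtain M where M: "M > 0" "\<And>x. x \<in> {-pi..pi} \<Longrightarrow> \<bar>f x\<bar> \<le> M"
    unfolding bounded_pos by auto
  have "norm (fourier_coeff (\<lambda>x. f x * f x) 0) \<le> e" if e: "e > 0" for e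
  proof -
    \<comment> \<open>The tolerance \<open>e / M\<close> becomes \<open>e\<close> after
      multiplication by the bound \<open>M\<close> of \<open>f\<close>.\<close>
    obtain p where p: "real_polynomial_function p" "\<And>z. z \<in> sphere 0 1 \<Longrightarrow> \<bar>f (Arg z) - p z\<bar> < e / M"
      using Stone_Weierstrass_real_polynomial_function[OF compact_sphere
          continuous_on_periodic_Arg[OF cont per] divide_pos_pos[OF e M(1)]] by blast
    have fp: "\<bar>f x - p (cis x)\<bar> \<le> e / M" for x
    proof -
      have "f (Arg (cis x)) = f x"
        by (rule periodic_cis_eq[OF per]) (simp add: cis_Arg)
      then show ?thesis
        using p(2)[of "cis x"] by simp
    qed
    note P = polynomial_cis_fourier_coeff_zero[OF p(1) contf zero]
    \<comment> \<open>The subtracted product has vanishing coefficients by orthogonality, so the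
      mean is unchanged.\<close>
    have "fourier_coeff (\<lambda>x. f x * f x) 0 = fourier_coeff (\<lambda>x. f x * f x - f x * p (cis x)) 0"
      using P by (subst fourier_coeff_diff) (auto intro!: continuous_intros contf)
    also have "norm \<dots> \<le> e"
    proof (rule norm_fourier_coeff_le)
      show "continuous_on {-pi..pi} (\<lambda>x. f x * f x - f x * p (cis x))"
        by (intro continuous_on_diff conjunct1[OF P] continuous_on_mult contf)
      fix x assume "x \<in> {-pi..pi}"
      have "\<bar>f x * f x - f x * p (cis x)\<bar> = \<bar>f x\<bar> * \<bar>f x - p (cis x)\<bar>"
        by (simp add: abs_mult[symmetric] algebra_simps)
      also have "\<dots> \<le> M * (e / M)"
        using M(1) by (intro mult_mono M(2)[OF \<open>x \<in> _\<close>] fp) simp_all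
      also have "M * (e / M) = e"
        using M(1) by simp
      finally show "\<bar>f x * f x - f x * p (cis x)\<bar> \<le> e" .
    qed
    finally show ?thesis .
  qed
  then have "norm (fourier_coeff (\<lambda>x. f x * f x) 0) \<le> 0"
    by (rule field_le_epsilon) simp
  then have "integral {-pi..pi} (\<lambda>x. complex_of_real (f x * f x)) = 0"
    by (simp add: fourier_coeff_def)
  moreover have "(\<lambda>x. f x * f x) integrable_on {-pi..pi}"
    by (intro integrable_continuous_real continuous_intros contf)
  ultimately have "integral {-pi..pi} (\<lambda>x. f x * f x) = 0"
    using integral_linear[OF _ bounded_linear_of_real[where 'a=complex], of "\<lambda>x. f x * f x" "{-pi..pi}"]
    by (auto simp: o_def)
  then have "\<forall>x\<in>{-pi..pi}. f x * f x = 0"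
    by (subst (asm) integral_eq_0_iff) (auto intro!: continuous_intros contf)
  moreover obtain y where "y \<in> {-pi..pi}" "f x = f y"
    using periodic_reduce[OF per] by blast
  ultimately show ?thesis by simp
qed

lemma fourier_coeff_inject:
  assumes "continuous_on UNIV f" "periodic f" "continuous_on UNIV g" "periodic g"
    and "\<And>k. fourier_coeff f k = fourier_coeff g k"
  shows "f = g"
proof
  fix x
  have "f x - g x = 0"
  proof (rule fourier_coeff_zero_imp_zero[where f = "\<lambda>x. f x - g x"])
    show "continuous_on UNIV (\<lambda>x. f x - g x)"
      using assms by (auto intro!: continuous_intros)
    show "periodic (\<lambda>x. f x - g x)"
      using assms by (auto simp: periodic_def)
    show "fourier_coeff (\<lambda>x. f x - g x) k = 0" for k
      using assms by (subst fourier_coeff_diff) (auto intro: continuous_on_subset)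
  qed
  then show "f x = g x" by simp
qed

text \<open>Discharges the definite description: a multiplier is evaluated by exhibiting a
  continuous periodic function with the right coefficients.\<close>

lemma fourier_multiplier_eqI:
  assumes "continuous_on UNIV g" "periodic g" "\<And>k. fourier_coeff g k = m k * fourier_coeff f k"
  shows "fourier_multiplier m f = g"
  unfolding fourier_multiplier_def
proof (rule the_equality)
  fix g' assume "continuous_on UNIV g' \<and> periodic g' \<and> (\<forall>k. fourier_coeff g' k = m k * fourier_coeff f k)"
  then show "g' = g"
    by (intro fourier_coeff_inject) (simp_all add: assms)
qed (simp add: assms)

section \<open>The Hilbert transform of a smooth function\<close>

lemma integral_exp_int:
  "integral {-pi..pi} (\<lambda>x. exp (\<i> * of_int j * complex_of_real x)) = (if j = 0 then 2 * of_real pi else 0)"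
proof (cases "j = 0")
  case False
  have "((\<lambda>x. exp (\<i> * of_int j * of_real x)) has_integral
      (exp (\<i> * of_int j * of_real pi) / (\<i> * of_int j) - exp (\<i> * of_int j * of_real (-pi)) / (\<i> * of_int j)))
      {-pi..pi}"
    by (rule fundamental_theorem_of_calculus, simp, rule has_vector_derivative_real_field)
       (use False in \<open>auto intro!: derivative_eq_intros\<close>)
  moreover have "exp (\<i> * of_int j * of_real pi) = exp (\<i> * of_int j * complex_of_real (-pi))"
    using exp_int_pi_eq[of "-j"] by simp
  ultimately show ?thesis
    using False by (simp add: integral_unique)
qed (simp add: scaleR_conv_of_real)

text \<open>One block of the Hilbert series, from \<open>2 Im z = - \<i> (z - cnj z)\<close>. When
  \<open>c\<close> is the coefficient of a real function at \<open>m\<close>, the values at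
  \<open>m\<close> and \<open>- m\<close> are those prescribed by the symbol
  \<open>- \<i> sgn k\<close>.\<close>

lemma fourier_coeff_Im_exp:
  assumes "m > 0"
  shows "fourier_coeff (\<lambda>x. 2 * Im (c * exp (\<i> * of_int m * of_real x))) k =
    (if k = m then - \<i> * c else if k = - m then \<i> * cnj c else 0)"
proof -
  let ?E = "\<lambda>j x. exp (\<i> * of_int j * complex_of_real x)"
  have int: "(\<lambda>x. a * ?E j x) integrable_on {-pi..pi}" for a j
    by (intro integrable_continuous_real continuous_intros)
  have "of_real (2 * Im (c * ?E m x)) * exp (- \<i> * of_int k * of_real x) =
      (- \<i> * c) * ?E (m - k) x + (\<i> * cnj c) * ?E (- m - k) x" for x
  proof -
    have "complex_of_real (2 * Im z) = - \<i> * (z - cnj z)" for z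
      by (simp add: complex_eq_iff)
    moreover have "cnj (c * ?E m x) = cnj c * ?E (- m) x"
      by (simp add: exp_cnj)
    ultimately have "complex_of_real (2 * Im (c * ?E m x)) = - \<i> * (c * ?E m x - cnj c * ?E (- m) x)"
      by (simp only:)
    moreover have "?E (m - k) x = ?E m x * exp (- \<i> * of_int k * of_real x)"
        "?E (- m - k) x = ?E (- m) x * exp (- \<i> * of_int k * of_real x)"
      unfolding exp_add[symmetric] by (rule arg_cong[of _ _ exp]; simp add: algebra_simps)+
    ultimately show ?thesis
      by (simp only:) (simp only: ring_distribs minus_mult_left[symmetric] mult.assoc, simp)
  qed
  then have "integral {-pi..pi} (\<lambda>x. of_real (2 * Im (c * ?E m x)) * exp (- \<i> * of_int k * of_real x)) =
      (- \<i> * c) * integral {-pi..pi} (?E (m - k)) + (\<i> * cnj c) * integral {-pi..pi} (?E (- m - k))"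
    by (simp only: integral_add[OF int int] integral_mult_right)
  then show ?thesis
    using assms unfolding fourier_coeff_def integral_exp_int by auto
qed

lemma periodic_derivative:
  assumes "periodic f" "\<And>x. (f has_real_derivative f' x) (at x)"
  shows "periodic f'"
  unfolding periodic_def
proof
  fix x
  have "((\<lambda>x. f (x + 2 * pi)) has_real_derivative f' (x + 2 * pi)) (at x)"
    using assms(2) by (simp add: DERIV_shift[symmetric])
  moreover have "(\<lambda>x. f (x + 2 * pi)) = f"
    using assms(1) by (auto simp: periodic_def)
  ultimately show "f' (x + 2 * pi) = f' x"
    using assms(2) DERIV_unique by metis
qed

text \<open>Equals \<open>pi^2 / 3\<close>. The 2 comes from \<open>2 Im\<close>, and the inverse
  squares from two integrations by parts. It does not depend on the function, which keeps later
  bounds uniform in time.\<close>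

definition hilbert_const :: real
  where "hilbert_const = (\<Sum>n. 2 / real (Suc n) ^ 2)"

lemma summable_hilbert_const: "summable (\<lambda>n. 2 / real (Suc n) ^ 2)"
  using summable_mult[OF summable_Suc_iff[THEN iffD2, OF inverse_power_summable[OF order_refl, where ?'a=real]], of 2]
  by (simp add: divide_inverse power_inverse)

text \<open>
  The multiplier is realised by the series of \<open>2 Im (c\<^sub>n exp (i n x))\<close> over positive \<open>n\<close>, which is real and
  converges because \<open>|c\<^sub>n| \<le> M / n\<^sup>2\<close>.
\<close>

lemma hilbert_multiplier_exists:
  assumes per: "periodic f"
    and f1: "\<And>x. (f has_real_derivative f1 x) (at x)"
    and f2: "\<And>x. (f1 has_real_derivative f2 x) (at x)"
    and cont: "continuous_on UNIV f2"
    and M: "\<And>x. \<bar>f2 x\<bar> \<le> M"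
  obtains g where "continuous_on UNIV g" "periodic g"
    "\<And>k. fourier_coeff g k = - \<i> * of_int (sgn k) * fourier_coeff f k"
    "\<And>x. \<bar>g x\<bar> \<le> hilbert_const * M"
proof -
  \<comment> \<open>The index \<open>Suc n\<close> leaves out frequency 0, in agreement with
    \<open>sgn 0 = 0\<close>.\<close>
  define c where "c n = fourier_coeff f (int (Suc n))" for n
  define F where "F n x = 2 * Im (c n * exp (\<i> * of_int (int (Suc n)) * of_real x))" for n x
  define g where "g x = (\<Sum>n. F n x)" for x
  have cont1: "continuous_on UNIV f1"
    using f2 DERIV_continuous_on has_field_derivative_at_within by blast
  have c: "norm (c n) \<le> M / real (Suc n) ^ 2" for n
  proof -
    have "fourier_coeff f2 (int (Suc n)) = \<i> * of_int (int (Suc n)) * (\<i> * of_int (int (Suc n)) * c n)"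
      using fourier_coeff_deriv[OF per f1 continuous_on_subset[OF cont1]]
        fourier_coeff_deriv[OF periodic_derivative[OF per f1] f2 continuous_on_subset[OF cont]]
      unfolding c_def by simp
    then have "real (Suc n) ^ 2 * norm (c n) = norm (fourier_coeff f2 (int (Suc n)))"
      by (simp add: norm_mult power2_eq_square del: of_nat_Suc)
    also have "\<dots> \<le> M"
      using M by (intro norm_fourier_coeff_le continuous_on_subset[OF cont]) auto
    finally show ?thesis
      by (simp add: field_simps del: of_nat_Suc)
  qed
  have F: "\<bar>F n x\<bar> \<le> 2 / real (Suc n) ^ 2 * M" for n x
  proof -
    have "\<bar>F n x\<bar> \<le> 2 * norm (c n * exp (\<i> * of_int (int (Suc n)) * of_real x))"
      using abs_Im_le_cmod[of "c n * exp (\<i> * of_int (int (Suc n)) * of_real x)"]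
      by (simp only: F_def abs_mult)
    also have "\<dots> = 2 * norm (c n)"
      by (simp add: norm_mult norm_exp_eq_Re)
    finally show ?thesis using c[of n] by simp
  qed
  have sumM: "summable (\<lambda>n. 2 / real (Suc n) ^ 2 * M)"
    by (intro summable_mult2 summable_hilbert_const)
  have lim: "uniform_limit UNIV (\<lambda>n x. \<Sum>i<n. F i x) g sequentially"
    unfolding g_def by (rule Weierstrass_m_test[OF _ sumM]) (use F in simp)
  have contF: "continuous_on S (\<lambda>x. \<Sum>i<n. F i x)" for n S
    unfolding F_def by (intro continuous_intros)
  have contg: "continuous_on UNIV g"
    by (rule uniform_limit_theorem[OF _ lim]) (simp_all add: contF)
  \<comment> \<open>The partial sums carry exactly the desired coefficients up to frequency
    \<open>n\<close>, so each coefficient is eventually constant in \<open>n\<close> and the limit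
    below is immediate.\<close>
  have coeffs: "fourier_coeff (\<lambda>x. \<Sum>i<n. F i x) k =
      (if \<bar>k\<bar> \<le> int n then - \<i> * of_int (sgn k) * fourier_coeff f k else 0)" for n k
  proof (induction n)
    case 0
    show ?case by (simp add: fourier_coeff_def)
  next
    case (Suc n)
    have "continuous_on {-pi..pi} (F n)"
      unfolding F_def by (intro continuous_intros)
    then have "fourier_coeff (\<lambda>x. \<Sum>i<Suc n. F i x) k =
       (if \<bar>k\<bar> \<le> int n then - \<i> * of_int (sgn k) * fourier_coeff f k else 0) + fourier_coeff (F n) k"
      using Suc by (simp add: fourier_coeff_add contF)
    also have "fourier_coeff (F n) k = (if k = int (Suc n) then - \<i> * c n 
       else if k = - int (Suc n) then \<i> * cnj (c n) else 0)"
      unfolding F_def by (rule fourier_coeff_Im_exp) simp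
    also have "cnj (c n) = fourier_coeff f (- int (Suc n))"
      unfolding c_def by (rule fourier_coeff_uminus[symmetric])
    finally show ?case
      by (auto simp: c_def)
  qed
  have "fourier_coeff g k = - \<i> * of_int (sgn k) * fourier_coeff f k" for k
  proof (rule LIMSEQ_unique)
    show "(\<lambda>n. fourier_coeff (\<lambda>x. \<Sum>i<n. F i x) k) \<longlonglongrightarrow> fourier_coeff g k"
      by (rule fourier_coeff_tendsto[OF uniform_limit_on_subset[OF lim]])
         (auto simp: contF continuous_on_subset[OF contg])
    show "(\<lambda>n. fourier_coeff (\<lambda>x. \<Sum>i<n. F i x) k) \<longlonglongrightarrow> - \<i> * of_int (sgn k) * fourier_coeff f k"
      by (rule tendsto_eventually, rule eventually_sequentiallyI[of "nat \<bar>k\<bar>"]) (simp add: coeffs)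
  qed
  moreover have "periodic g"
    unfolding periodic_def
  proof
    fix x
    have "exp (\<i> * of_int m * complex_of_real (x + 2 * pi)) = exp (\<i> * of_int m * of_real x)" for m
      using exp_plus_2pin[of "\<i> * of_int m * of_real x" m] by (simp add: algebra_simps)
    then show "g (x + 2 * pi) = g x"
      unfolding g_def F_def by (simp only:)
  qed
  moreover have "\<bar>g x\<bar> \<le> hilbert_const * M" for x
  proof -
    have "norm (\<Sum>n. F n x) \<le> (\<Sum>n. 2 / real (Suc n) ^ 2 * M)"
      by (rule norm_suminf_le[OF _ sumM]) (use F in simp)
    also have "\<dots> = hilbert_const * M"
      unfolding hilbert_const_def by (rule suminf_mult2[symmetric, OF summable_hilbert_const])
    finally show ?thesis by (simp add: g_def)
  qed
  ultimately show ?thesis using contg that by blast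
qed

lemma hilbert_eqI:
  assumes "continuous_on UNIV g" "periodic g"
    "\<And>k. fourier_coeff g k = - \<i> * of_int (sgn k) * fourier_coeff f k"
  shows "hilbert f = g"
  unfolding hilbert_def using assms by (rule fourier_multiplier_eqI)

section \<open>Constants, antiderivatives and the values of \<open>hilbert\<close>\<close>

lemma fourier_coeff_const: "fourier_coeff (\<lambda>x. c) k = (if k = 0 then of_real c else 0)"
proof (cases "k = 0")
  case True
  then show ?thesis by (simp add: fourier_coeff_def scaleR_conv_of_real)
next
  case False
  \<comment> \<open>A constant has derivative 0, so its coefficient is annihilated by the nonzero
    factor \<open>\<i> k\<close>.\<close>
  have "fourier_coeff (\<lambda>x. 0) k = \<i> * of_int k * fourier_coeff (\<lambda>x. c) k"
    by (rule fourier_coeff_deriv) (auto simp: periodic_def)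
  then show ?thesis
    using False by (simp add: fourier_coeff_def)
qed

text \<open>The increment of an antiderivative over one period is constant, and equals the integral
  of \<open>f\<close> over a period, which vanishes with the mean. It gives the derivative of a
  Hilbert transform without differentiating a series term by term.\<close>

lemma periodic_antiderivative:
  assumes cont: "continuous_on UNIV f" and per: "periodic f" and zero: "fourier_coeff f 0 = 0"
  obtains F where "periodic F" "\<And>x. (F has_real_derivative f x) (at x)"
proof -
  have "isCont f x" for x
    using cont by (metis continuous_on_eq_continuous_at UNIV_I open_UNIV)
  then obtain F where "\<And>x. (F has_vector_derivative f x) (at x)"
    using einterval_antiderivative[of "-\<infinity>" "\<infinity>" f] by auto
  then have F: "(F has_real_derivative f x) (at x)" for x
    by (simp add: has_real_derivative_iff_has_vector_derivative)
  have "((\<lambda>x. F (x + 2 * pi) - F x) has_real_derivative 0) (at x)" for x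
  proof -
    have "((\<lambda>x. F (x + 2 * pi)) has_real_derivative f (x + 2 * pi)) (at x)"
      using F by (simp add: DERIV_shift[symmetric])
    then show ?thesis
      using DERIV_diff[OF _ F[of x], of "\<lambda>x. F (x + 2 * pi)" "f (x + 2 * pi)"] per
      by (simp add: periodic_def)
  qed
  then have const: "F (x + 2 * pi) - F x = F (- pi + 2 * pi) - F (- pi)" for x
    by (rule DERIV_isconst_all[rule_format, of "\<lambda>x. F (x + 2 * pi) - F x"])
  have contf: "continuous_on {-pi..pi} f"
    using cont continuous_on_subset by blast
  have "(f has_integral (F pi - F (-pi))) {-pi..pi}"
    by (rule fundamental_theorem_of_calculus)
       (auto simp flip: has_real_derivative_iff_has_vector_derivative intro: has_field_derivative_at_within F)
  then have "F pi - F (-pi) = integral {-pi..pi} f"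
    by (simp add: integral_unique)
  moreover have "complex_of_real (integral {-pi..pi} f) = integral {-pi..pi} (\<lambda>x. of_real (f x))"
    using integral_linear[OF integrable_continuous_real[OF contf] bounded_linear_of_real[where 'a=complex]]
    by (simp add: o_def)
  ultimately have "F pi - F (-pi) = 0"
    using zero by (simp add: fourier_coeff_def)
  then have "periodic F"
    using const by (simp add: periodic_def)
  with F show ?thesis using that by blast
qed

lemma hilbert_props:
  assumes "periodic f" "\<And>x. (f has_real_derivative f1 x) (at x)" "\<And>x. (f1 has_real_derivative f2 x) (at x)"
    "continuous_on UNIV f2" "\<And>x. \<bar>f2 x\<bar> \<le> M"
  shows "continuous_on UNIV (hilbert f)" "periodic (hilbert f)"
    "fourier_coeff (hilbert f) k = - \<i> * of_int (sgn k) * fourier_coeff f k"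
    "\<bar>hilbert f x\<bar> \<le> hilbert_const * M"
proof -
  obtain g where g: "continuous_on UNIV g" "periodic g"
    "\<And>k. fourier_coeff g k = - \<i> * of_int (sgn k) * fourier_coeff f k"
    "\<And>x. \<bar>g x\<bar> \<le> hilbert_const * M"
    using hilbert_multiplier_exists[OF assms] by blast
  have "hilbert f = g"
    by (rule hilbert_eqI[OF g(1-3)])
  with g show "continuous_on UNIV (hilbert f)" "periodic (hilbert f)"
    "fourier_coeff (hilbert f) k = - \<i> * of_int (sgn k) * fourier_coeff f k"
    "\<bar>hilbert f x\<bar> \<le> hilbert_const * M"
    by auto
qed

section \<open>Uniformly smooth families of periodic functions\<close>

text \<open>
  The bounds are uniform in the index \<open>i\<close>, which will be time.
\<close>

primrec bounded_Ck :: "nat \<Rightarrow> 'i set \<Rightarrow> ('i \<Rightarrow> real \<Rightarrow> real) \<Rightarrow> bool"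
where
  "bounded_Ck 0 I f \<longleftrightarrow> (\<exists>M. \<forall>i\<in>I. \<forall>x. \<bar>f i x\<bar> \<le> M)"
| "bounded_Ck (Suc n) I f \<longleftrightarrow> (\<exists>M. \<forall>i\<in>I. \<forall>x. \<bar>f i x\<bar> \<le> M) \<and>
     (\<exists>f'. (\<forall>i\<in>I. \<forall>x. (f i has_real_derivative f' i x) (at x)) \<and> bounded_Ck n I f')"

definition smooth_family :: "'i set \<Rightarrow> ('i \<Rightarrow> real \<Rightarrow> real) \<Rightarrow> bool"
  where "smooth_family I f \<longleftrightarrow> (\<forall>i\<in>I. periodic (f i)) \<and> (\<forall>n. bounded_Ck n I f)"

lemma bounded_Ck_cong:
  assumes "\<And>i. i \<in> I \<Longrightarrow> f i = g i"
  shows "bounded_Ck n I f = bounded_Ck n I g"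
  by (cases n) (simp_all add: assms cong: ball_cong)

lemma bounded_Ck_bound: "bounded_Ck n I f \<Longrightarrow> \<exists>M. \<forall>i\<in>I. \<forall>x. \<bar>f i x\<bar> \<le> M"
  by (cases n) auto

lemma bounded_Ck_SucD: "bounded_Ck (Suc n) I f \<Longrightarrow> bounded_Ck n I f"
  by (induction n arbitrary: f) auto

lemma bounded_Ck_SucI:
  assumes "\<exists>M. \<forall>i\<in>I. \<forall>x. \<bar>f i x\<bar> \<le> M"
    and "\<forall>i\<in>I. \<forall>x. (f i has_real_derivative f' i x) (at x)" "bounded_Ck n I f'"
  shows "bounded_Ck (Suc n) I f"
  using assms by auto

lemma bounded_Ck_const: "bounded_Ck n I (\<lambda>i x. c)"
proof (induction n arbitrary: c)
  case (Suc n)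
  show ?case
    by (rule bounded_Ck_SucI[OF _ _ Suc[of 0]]) auto
qed auto

lemma bounded_family_add:
  fixes f g :: "'i \<Rightarrow> real \<Rightarrow> real"
  assumes "\<exists>M. \<forall>i\<in>I. \<forall>x. \<bar>f i x\<bar> \<le> M" "\<exists>M. \<forall>i\<in>I. \<forall>x. \<bar>g i x\<bar> \<le> M"
  shows "\<exists>M. \<forall>i\<in>I. \<forall>x. \<bar>f i x + g i x\<bar> \<le> M"
proof -
  obtain M N where "\<forall>i\<in>I. \<forall>x. \<bar>f i x\<bar> \<le> M" "\<forall>i\<in>I. \<forall>x. \<bar>g i x\<bar> \<le> N"
    using assms by auto
  then have "\<forall>i\<in>I. \<forall>x. \<bar>f i x + g i x\<bar> \<le> M + N"
    by (meson abs_triangle_ineq add_mono order_trans)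
  then show ?thesis ..
qed

lemma bounded_family_mult:
  fixes f g :: "'i \<Rightarrow> real \<Rightarrow> real"
  assumes "\<exists>M. \<forall>i\<in>I. \<forall>x. \<bar>f i x\<bar> \<le> M" "\<exists>M. \<forall>i\<in>I. \<forall>x. \<bar>g i x\<bar> \<le> M"
  shows "\<exists>M. \<forall>i\<in>I. \<forall>x. \<bar>f i x * g i x\<bar> \<le> M"
proof -
  obtain M N where MN: "\<forall>i\<in>I. \<forall>x. \<bar>f i x\<bar> \<le> M" "\<forall>i\<in>I. \<forall>x. \<bar>g i x\<bar> \<le> N"
    using assms by auto
  have "\<forall>i\<in>I. \<forall>x. \<bar>f i x * g i x\<bar> \<le> M * N"
  proof (intro ballI allI)
    fix i x assume "i \<in> I"
    with MN have "\<bar>f i x\<bar> \<le> M" "\<bar>g i x\<bar> \<le> N" by auto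
    then show "\<bar>f i x * g i x\<bar> \<le> M * N"
      unfolding abs_mult by (rule mult_mono) (use \<open>\<bar>f i x\<bar> \<le> M\<close> in linarith, simp)
  qed
  then show ?thesis ..
qed

lemma bounded_Ck_add: "bounded_Ck n I f \<Longrightarrow> bounded_Ck n I g \<Longrightarrow> bounded_Ck n I (\<lambda>i x. f i x + g i x)"
proof (induction n arbitrary: f g)
  case 0
  then show ?case by (simp add: bounded_family_add)
next
  case (Suc n)
  then obtain f' g' where 
    d: "\<forall>i\<in>I. \<forall>x. (f i has_real_derivative f' i x) (at x)" "\<forall>i\<in>I. \<forall>x. (g i has_real_derivative g' i x) (at x)"
    and b: "bounded_Ck n I f'" "bounded_Ck n I g'"
    by auto
  have "\<forall>i\<in>I. \<forall>x. ((\<lambda>x. f i x + g i x) has_real_derivative f' i x + g' i x) (at x)"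
    using d by (auto intro: DERIV_add)
  then show ?case
    by (rule bounded_Ck_SucI[OF
          bounded_family_add[OF bounded_Ck_bound[OF Suc.prems(1)] bounded_Ck_bound[OF Suc.prems(2)]] _
          Suc.IH[OF b]])
qed

lemma bounded_Ck_mult: "bounded_Ck n I f \<Longrightarrow> bounded_Ck n I g \<Longrightarrow> bounded_Ck n I (\<lambda>i x. f i x * g i x)"
proof (induction n arbitrary: f g)
  case 0
  then show ?case by (simp add: bounded_family_mult)
next
  case (Suc n)
  then obtain f' g' where 
    d: "\<forall>i\<in>I. \<forall>x. (f i has_real_derivative f' i x) (at x)" "\<forall>i\<in>I. \<forall>x. (g i has_real_derivative g' i x) (at x)"
    and b: "bounded_Ck n I f'" "bounded_Ck n I g'"
    by auto
  have "\<forall>i\<in>I. \<forall>x. ((\<lambda>x. f i x * g i x) has_real_derivative f' i x * g i x + g' i x * f i x) (at x)"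
    using d by (auto intro: DERIV_mult)
  moreover have "bounded_Ck n I (\<lambda>i x. f' i x * g i x + g' i x * f i x)"
    using Suc.prems[THEN bounded_Ck_SucD] b by (intro bounded_Ck_add Suc.IH)
  ultimately show ?case
    by (rule bounded_Ck_SucI[OF
          bounded_family_mult[OF bounded_Ck_bound[OF Suc.prems(1)] bounded_Ck_bound[OF Suc.prems(2)]]])
qed

section \<open>Closure properties of smooth families\<close>

lemma smooth_family_const: "smooth_family I (\<lambda>i x. c)"
  by (simp add: smooth_family_def bounded_Ck_const periodic_def)

lemma smooth_family_add:
  "smooth_family I f \<Longrightarrow> smooth_family I g \<Longrightarrow> smooth_family I (\<lambda>i x. f i x + g i x)"
  by (simp add: smooth_family_def bounded_Ck_add periodic_def)

lemma smooth_family_mult: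
  "smooth_family I f \<Longrightarrow> smooth_family I g \<Longrightarrow> smooth_family I (\<lambda>i x. f i x * g i x)"
  by (simp add: smooth_family_def bounded_Ck_mult periodic_def)

lemma smooth_family_cmult: "smooth_family I f \<Longrightarrow> smooth_family I (\<lambda>i x. c * f i x)"
  using smooth_family_mult[OF smooth_family_const] .

lemma smooth_family_minus: "smooth_family I f \<Longrightarrow> smooth_family I (\<lambda>i x. - f i x)"
  using smooth_family_cmult[of I f "-1"] by simp

lemma smooth_family_diff:
  "smooth_family I f \<Longrightarrow> smooth_family I g \<Longrightarrow> smooth_family I (\<lambda>i x. f i x - g i x)"
  using smooth_family_add[OF _ smooth_family_minus, of I f g] by simp

lemma smooth_family_cong:
  "(\<And>i. i \<in> I \<Longrightarrow> f i = g i) \<Longrightarrow> smooth_family I f = smooth_family I g"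
  unfolding smooth_family_def by (simp add: bounded_Ck_cong[of I f g])

lemma smooth_family_bound:
  assumes "smooth_family I f" obtains M where "\<And>i x. i \<in> I \<Longrightarrow> \<bar>f i x\<bar> \<le> M"
proof -
  have "bounded_Ck 0 I f" using assms by (simp add: smooth_family_def)
  then show ?thesis using that by auto
qed

lemma smooth_family_periodic: "smooth_family I f \<Longrightarrow> i \<in> I \<Longrightarrow> periodic (f i)"
  by (simp add: smooth_family_def)

lemma smooth_family_has_deriv:
  assumes "smooth_family I f" "i \<in> I"
  shows "(f i has_real_derivative deriv (f i) x) (at x)"
proof -
  have "bounded_Ck (Suc 0) I f" using assms by (simp add: smooth_family_def del: bounded_Ck.simps)
  then obtain f' where "\<forall>i\<in>I. \<forall>x. (f i has_real_derivative f' i x) (at x)" by auto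
  then have "(f i has_real_derivative f' i x) (at x)" using assms(2) by blast
  then show ?thesis using DERIV_imp_deriv by metis
qed

text \<open>\<open>bounded_Ck\<close> supplies a possibly different derivative witness for each
  order; uniqueness of derivatives identifies all of them with \<open>deriv\<close>.\<close>

lemma smooth_family_deriv:
  assumes "smooth_family I f"
  shows "smooth_family I (\<lambda>i. deriv (f i))"
proof -
  have "bounded_Ck n I (\<lambda>i. deriv (f i))" for n
  proof -
    have "bounded_Ck (Suc n) I f" using assms by (simp add: smooth_family_def del: bounded_Ck.simps)
    then obtain f' where f': "\<forall>i\<in>I. \<forall>x. (f i has_real_derivative f' i x) (at x)" "bounded_Ck n I f'"
      by auto
    have "deriv (f i) = f' i" if "i \<in> I" for i
      by (rule ext, rule DERIV_imp_deriv) (use f'(1) that in blast)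
    from bounded_Ck_cong[of I "\<lambda>i. deriv (f i)" f', OF this] f'(2) show ?thesis
      by (rule iffD2)
  qed
  moreover have "periodic (deriv (f i))" if "i \<in> I" for i
    by (rule periodic_derivative[OF smooth_family_periodic[OF assms that] smooth_family_has_deriv[OF assms that]])
  ultimately show ?thesis unfolding smooth_family_def by (intro conjI ballI allI)
qed

lemma smooth_family_continuous: "smooth_family I f \<Longrightarrow> i \<in> I \<Longrightarrow> continuous_on S (f i)"
  by (rule DERIV_continuous_on[OF has_field_derivative_at_within[OF smooth_family_has_deriv]])

lemma smooth_family_fourier_deriv:
  assumes "smooth_family I f" "i \<in> I"
  shows "fourier_coeff (deriv (f i)) k = \<i> * of_int k * fourier_coeff (f i) k"
  by (rule fourier_coeff_deriv[OF smooth_family_periodic[OF assms] smooth_family_has_deriv[OF assms]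
        smooth_family_continuous[OF smooth_family_deriv[OF assms(1)] assms(2)]])

lemma
  assumes f: "smooth_family I f"
  shows smooth_family_hilbert_continuous: "i \<in> I \<Longrightarrow> continuous_on UNIV (hilbert (f i))"
    and smooth_family_hilbert_periodic: "i \<in> I \<Longrightarrow> periodic (hilbert (f i))"
    and smooth_family_fourier_hilbert: 
      "i \<in> I \<Longrightarrow> fourier_coeff (hilbert (f i)) k = - \<i> * of_int (sgn k) * fourier_coeff (f i) k"
    and smooth_family_hilbert_bounded: "\<exists>M. \<forall>i\<in>I. \<forall>x. \<bar>hilbert (f i) x\<bar> \<le> M"
proof -
  note f1 = smooth_family_deriv[OF f]
  note f2 = smooth_family_deriv[OF f1]
  obtain M where M: "\<And>i x. i \<in> I \<Longrightarrow> \<bar>deriv (deriv (f i)) x\<bar> \<le> M"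
    using smooth_family_bound[OF f2] by blast
  note props = hilbert_props[OF smooth_family_periodic[OF f] smooth_family_has_deriv[OF f]
      smooth_family_has_deriv[OF f1] smooth_family_continuous[OF f2] M]
  show "i \<in> I \<Longrightarrow> continuous_on UNIV (hilbert (f i))" "i \<in> I \<Longrightarrow> periodic (hilbert (f i))"
    "i \<in> I \<Longrightarrow> fourier_coeff (hilbert (f i)) k = - \<i> * of_int (sgn k) * fourier_coeff (f i) k"
    using props(1-3) by blast+
  show "\<exists>M. \<forall>i\<in>I. \<forall>x. \<bar>hilbert (f i) x\<bar> \<le> M"
    using props(4) by blast
qed

text \<open>The transform of \<open>f'\<close> has mean zero, so it has a periodic antiderivative.
  That antiderivative has the coefficients of the transform of \<open>f\<close> except at frequency
  0, and subtracting its mean corrects this one.\<close>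

lemma hilbert_has_deriv:
  assumes f: "smooth_family I f" and i: "i \<in> I"
  shows "(hilbert (f i) has_real_derivative hilbert (deriv (f i)) x) (at x)"
proof -
  note f1 = smooth_family_deriv[OF f]
  let ?K = "hilbert (deriv (f i))"
  have K: "continuous_on UNIV ?K" "periodic ?K"
    "\<And>k. fourier_coeff ?K k = - \<i> * of_int (sgn k) * (\<i> * of_int k * fourier_coeff (f i) k)"
    using smooth_family_hilbert_continuous[OF f1 i] smooth_family_hilbert_periodic[OF f1 i]
      smooth_family_fourier_hilbert[OF f1 i] smooth_family_fourier_deriv[OF f i] by auto
  obtain A where A: "periodic A" "\<And>x. (A has_real_derivative ?K x) (at x)"
    using periodic_antiderivative[OF K(1,2)] K(3)[of 0] by auto
  have contA: "continuous_on S A" for S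
    using A(2) DERIV_continuous_on has_field_derivative_at_within by blast
  have coeffA: "\<i> * of_int k * fourier_coeff A k = - \<i> * of_int (sgn k) * (\<i> * of_int k * fourier_coeff (f i) k)" for k
    using fourier_coeff_deriv[OF A continuous_on_subset[OF K(1) subset_UNIV], of k] K(3)[of k] by simp
  \<comment> \<open>The zeroth coefficient equals its own conjugate, so taking the real part loses
    nothing and \<open>A x - a\<close> stays real.\<close>
  define a where "a = Re (fourier_coeff A 0)"
  have a: "fourier_coeff A 0 = of_real a"
    using fourier_coeff_uminus[of A 0] by (simp add: a_def complex_eq_iff)
  have "hilbert (f i) = (\<lambda>x. A x - a)"
  proof (rule hilbert_eqI)
    show "continuous_on UNIV (\<lambda>x. A x - a)" by (intro continuous_intros contA)
    show "periodic (\<lambda>x. A x - a)" using A(1) by (simp add: periodic_def)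
    fix k
    have "fourier_coeff (\<lambda>x. A x - a) k = fourier_coeff A k - (if k = 0 then of_real a else 0)"
      by (simp add: fourier_coeff_diff contA fourier_coeff_const)
    moreover have "(\<i> * of_int k) * fourier_coeff A k = (\<i> * of_int k) * (- \<i> * of_int (sgn k) * fourier_coeff (f i) k)"
      unfolding coeffA by (simp only: mult_ac)
    ultimately show "fourier_coeff (\<lambda>x. A x - a) k = - \<i> * of_int (sgn k) * fourier_coeff (f i) k"
      using a by (cases "k = 0") (simp_all only: mult_cancel_left, auto)
  qed
  then show ?thesis
    using DERIV_diff[OF A(2)[of x] DERIV_const[of a]] by simp
qed

text \<open>Since \<open>hilbert\<close> commutes with the derivative, its sup bound for arbitrary
  smooth families yields bounds of every order.\<close>

lemma smooth_family_hilbert: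
  assumes "smooth_family I f"
  shows "smooth_family I (\<lambda>i. hilbert (f i))"
proof -
  have "smooth_family I f \<Longrightarrow> bounded_Ck n I (\<lambda>i. hilbert (f i))" for n
  proof (induction n arbitrary: f)
    case 0
    then show ?case by (simp add: smooth_family_hilbert_bounded)
  next
    case (Suc n)
    have "bounded_Ck n I (\<lambda>i. hilbert (deriv (f i)))"
      by (rule Suc.IH[OF smooth_family_deriv[OF Suc.prems]])
    then show ?case
      using bounded_Ck_SucI[OF smooth_family_hilbert_bounded[OF Suc.prems], of "\<lambda>i. hilbert (deriv (f i))"]
        hilbert_has_deriv[OF Suc.prems] by blast
  qed
  then show ?thesis
    using smooth_family_hilbert_periodic[OF assms] assms by (simp add: smooth_family_def[of I "\<lambda>i. hilbert (f i)"])
qed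

section \<open>The linear operator and the commutator\<close>

lemma hilbert_add:
  assumes "smooth_family I f" "smooth_family I g" "i \<in> I"
  shows "hilbert (\<lambda>x. f i x + g i x) = (\<lambda>x. hilbert (f i) x + hilbert (g i) x)"
proof (rule hilbert_eqI)
  note H = smooth_family_hilbert[OF assms(1)] smooth_family_hilbert[OF assms(2)]
  note S = smooth_family_add[OF H]
  show "continuous_on UNIV (\<lambda>x. hilbert (f i) x + hilbert (g i) x)"
    by (rule smooth_family_continuous[OF S assms(3)])
  show "periodic (\<lambda>x. hilbert (f i) x + hilbert (g i) x)"
    by (rule smooth_family_periodic[OF S assms(3)])
  show "fourier_coeff (\<lambda>x. hilbert (f i) x + hilbert (g i) x) k =
      - \<i> * of_int (sgn k) * fourier_coeff (\<lambda>x. f i x + g i x) k" for k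
    using fourier_coeff_add[OF smooth_family_continuous[OF H(1) assms(3)] smooth_family_continuous[OF H(2) assms(3)], of k]
      fourier_coeff_add[OF smooth_family_continuous[OF assms(1,3)] smooth_family_continuous[OF assms(2,3)], of k]
      smooth_family_fourier_hilbert[OF assms(1,3), of k] smooth_family_fourier_hilbert[OF assms(2,3), of k]
    by (simp only: ring_distribs)
qed

lemma hilbert_cmult:
  assumes "smooth_family I f" "i \<in> I"
  shows "hilbert (\<lambda>x. c * f i x) = (\<lambda>x. c * hilbert (f i) x)"
proof (rule hilbert_eqI)
  note S = smooth_family_cmult[OF smooth_family_hilbert[OF assms(1)]]
  show "continuous_on UNIV (\<lambda>x. c * hilbert (f i) x)"
    by (rule smooth_family_continuous[OF S assms(2)])
  show "periodic (\<lambda>x. c * hilbert (f i) x)"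
    by (rule smooth_family_periodic[OF S assms(2)])
  show "fourier_coeff (\<lambda>x. c * hilbert (f i) x) k = - \<i> * of_int (sgn k) * fourier_coeff (\<lambda>x. c * f i x) k" for k
    unfolding fourier_coeff_cmult smooth_family_fourier_hilbert[OF assms] by (simp only: mult_ac)
qed

lemma hilbert_minus:
  assumes "smooth_family I f" "i \<in> I"
  shows "hilbert (\<lambda>x. - f i x) = (\<lambda>x. - hilbert (f i) x)"
  using hilbert_cmult[OF assms, of "-1"] by simp

lemma hilbert_diff:
  assumes "smooth_family I f" "smooth_family I g" "i \<in> I"
  shows "hilbert (\<lambda>x. f i x - g i x) = (\<lambda>x. hilbert (f i) x - hilbert (g i) x)"
  using hilbert_add[OF assms(1) smooth_family_minus[OF assms(2)] assms(3)] hilbert_minus[OF assms(2,3)]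
  by simp

lemma calderon_eq_hilbert_deriv:
  assumes f: "smooth_family I f" "i \<in> I"
  shows "calderon (f i) = hilbert (deriv (f i))"
  unfolding calderon_def
proof (rule fourier_multiplier_eqI)
  note f1 = smooth_family_deriv[OF f(1)]
  show "continuous_on UNIV (hilbert (deriv (f i)))" "periodic (hilbert (deriv (f i)))"
    using smooth_family_hilbert_continuous[OF f1 f(2)] smooth_family_hilbert_periodic[OF f1 f(2)] .
  have "- \<i> * of_int (sgn k) * (\<i> * of_int k * c) = of_int \<bar>k\<bar> * c" for k :: int and c
    by (cases k "0::int" rule: linorder_cases) (simp_all add: mult.assoc[symmetric])
  then show "fourier_coeff (hilbert (deriv (f i))) k = of_int \<bar>k\<bar> * fourier_coeff (f i) k" for k
    using smooth_family_fourier_hilbert[OF f1 f(2)] smooth_family_fourier_deriv[OF f] by simp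
qed

text \<open>On the symbol level \<open>|k|^2 = - (\<i> k)^2\<close>. This reduces the cube in
  \<open>lin_op\<close> to a single \<open>calderon\<close> applied to a second derivative.\<close>

lemma calderon_calderon:
  assumes f: "smooth_family I f" "i \<in> I"
  shows "calderon (calderon (f i)) = (\<lambda>x. - deriv (deriv (f i)) x)"
  unfolding calderon_eq_hilbert_deriv[OF f] unfolding calderon_def
proof (rule fourier_multiplier_eqI)
  note f1 = smooth_family_deriv[OF f(1)]
  note f2 = smooth_family_minus[OF smooth_family_deriv[OF f1]]
  show "continuous_on UNIV (\<lambda>x. - deriv (deriv (f i)) x)"
    by (rule smooth_family_continuous[OF f2 f(2)])
  show "periodic (\<lambda>x. - deriv (deriv (f i)) x)"
    by (rule smooth_family_periodic[OF f2 f(2)])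
  have alg: "- (\<i> * of_int k * (\<i> * of_int k * c)) = of_int \<bar>k\<bar> * (- \<i> * of_int (sgn k) * (\<i> * of_int k * c))" for k :: int and c
    by (cases k "0::int" rule: linorder_cases) simp_all
  show "fourier_coeff (\<lambda>x. - deriv (deriv (f i)) x) k = of_int \<bar>k\<bar> * fourier_coeff (hilbert (deriv (f i))) k" for k
    unfolding fourier_coeff_minus smooth_family_fourier_hilbert[OF f1 f(2)] 
      smooth_family_fourier_deriv[OF f1 f(2)] smooth_family_fourier_deriv[OF f] by (rule alg)
qed

text \<open>The Neumann datum \<open>g\<close> of the overview, with the outer derivative carried
  out.\<close>

definition flux :: "real \<Rightarrow> (real \<Rightarrow> real) \<Rightarrow> real \<Rightarrow> real"
  where "flux \<nu> u x = deriv u x - \<nu> * deriv (deriv (deriv u)) x"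

lemma smooth_family_flux:
  assumes "smooth_family I f"
  shows "smooth_family I (\<lambda>i. flux \<nu> (f i))"
  unfolding flux_def
  by (rule smooth_family_diff[OF smooth_family_deriv[OF assms]
        smooth_family_cmult[OF smooth_family_deriv[OF smooth_family_deriv[OF smooth_family_deriv[OF assms]]]]])

lemma lin_op_eq:
  assumes f: "smooth_family I f" "i \<in> I"
  shows "lin_op \<nu> (f i) = (\<lambda>x. - hilbert (flux \<nu> (f i)) x)"
proof -
  note f1 = smooth_family_deriv[OF f(1)]
  note f2 = smooth_family_deriv[OF f1]
  note f3 = smooth_family_deriv[OF f2]
  have "(calderon ^^ 3) (f i) = calderon (\<lambda>x. - deriv (deriv (f i)) x)"
    using calderon_calderon[OF f] by (simp add: numeral_3_eq_3)
  also have "\<dots> = hilbert (deriv (\<lambda>x. - deriv (deriv (f i)) x))"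
    by (rule calderon_eq_hilbert_deriv[OF smooth_family_minus[OF f2] f(2)])
  also have "deriv (\<lambda>x. - deriv (deriv (f i)) x) = (\<lambda>x. - deriv (deriv (deriv (f i))) x)"
    by (rule ext, rule DERIV_imp_deriv, rule DERIV_minus, rule smooth_family_has_deriv[OF f2 f(2)])
  also have "hilbert \<dots> = (\<lambda>x. - hilbert (deriv (deriv (deriv (f i)))) x)"
    by (rule hilbert_minus[OF f3 f(2)])
  finally have "(calderon ^^ 3) (f i) = (\<lambda>x. - hilbert (deriv (deriv (deriv (f i)))) x)" .
  moreover have "hilbert (flux \<nu> (f i)) = (\<lambda>x. hilbert (deriv (f i)) x - \<nu> * hilbert (deriv (deriv (deriv (f i)))) x)"
    unfolding flux_def
    using hilbert_diff[OF f1 smooth_family_cmult[OF f3] f(2)] hilbert_cmult[OF f3 f(2)] by simp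
  ultimately show ?thesis
    by (simp add: fun_eq_iff lin_op_def calderon_eq_hilbert_deriv[OF f])
qed

lemma smooth_family_lin_op:
  assumes "smooth_family I f"
  shows "smooth_family I (\<lambda>i. lin_op \<nu> (f i))"
  using smooth_family_minus[OF smooth_family_hilbert[OF smooth_family_flux[OF assms]]]
    smooth_family_cong[of I "\<lambda>i. lin_op \<nu> (f i)", OF lin_op_eq[OF assms]] by blast

text \<open>A combination of derivatives of periodic functions has mean zero. This is needed because
  \<open>hilbert\<close> forgets the mean.\<close>

lemma fourier_flux_0:
  assumes f: "smooth_family I f" "i \<in> I"
  shows "fourier_coeff (flux \<nu> (f i)) 0 = 0"
proof -
  note f1 = smooth_family_deriv[OF f(1)]
  note f2 = smooth_family_deriv[OF f1]
  note f3 = smooth_family_deriv[OF f2]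
  show ?thesis
    unfolding flux_def
    using fourier_coeff_diff[OF smooth_family_continuous[OF f1 f(2)] 
        smooth_family_continuous[OF smooth_family_cmult[OF f3] f(2)], of \<nu> 0]
      smooth_family_fourier_deriv[OF f, of 0] smooth_family_fourier_deriv[OF f2 f(2), of 0]
    by (simp add: fourier_coeff_cmult)
qed

text \<open>On functions of mean zero the Hilbert transform squares to minus the identity, so the
  sign in \<open>lin_op_eq\<close> is undone.\<close>

lemma hilbert_lin_op:
  assumes f: "smooth_family I f" "i \<in> I"
  shows "hilbert (lin_op \<nu> (f i)) = flux \<nu> (f i)"
proof (rule hilbert_eqI)
  note g = smooth_family_flux[OF f(1), of \<nu>]
  show "continuous_on UNIV (flux \<nu> (f i))" by (rule smooth_family_continuous[OF g f(2)])
  show "periodic (flux \<nu> (f i))" by (rule smooth_family_periodic[OF g f(2)])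
  have alg: "c = - \<i> * of_int (sgn k) * - (- \<i> * of_int (sgn k) * c)" if "k = 0 \<Longrightarrow> c = 0" for k :: int and c
    using that by (cases k "0::int" rule: linorder_cases) simp_all
  show "fourier_coeff (flux \<nu> (f i)) k = - \<i> * of_int (sgn k) * fourier_coeff (lin_op \<nu> (f i)) k" for k
    unfolding lin_op_eq[OF f] fourier_coeff_minus smooth_family_fourier_hilbert[OF g f(2)]
    by (rule alg) (simp add: fourier_flux_0[OF f])
qed

text \<open>The polarised form of \<open>quad_op\<close>: the derivative of the commutator of
  \<open>u\<close> with \<open>hilbert\<close>, applied to \<open>lin_op \<nu> v\<close>. Here
  \<open>hilbert (lin_op \<nu> v)\<close> is already replaced by \<open>flux \<nu> v\<close>. Two
  arguments are kept for the cross terms.\<close>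

definition commutator_deriv :: "real \<Rightarrow> (real \<Rightarrow> real) \<Rightarrow> (real \<Rightarrow> real) \<Rightarrow> real \<Rightarrow> real"
  where "commutator_deriv \<nu> u v x =
    deriv u x * flux \<nu> v x + deriv (flux \<nu> v) x * u x - hilbert (deriv (\<lambda>y. u y * lin_op \<nu> v y)) x"

lemma hilbert_commutator_has_deriv:
  assumes f: "smooth_family I f" and g: "smooth_family I g" and i: "i \<in> I"
  shows "(hilbert_commutator (f i) (lin_op \<nu> (g i)) has_real_derivative
    commutator_deriv \<nu> (f i) (g i) x) (at x)"
proof -
  note fg = smooth_family_mult[OF f smooth_family_lin_op[OF g, of \<nu>]]
  have "hilbert_commutator (f i) (lin_op \<nu> (g i)) =
      (\<lambda>x. f i x * flux \<nu> (g i) x - hilbert (\<lambda>y. f i y * lin_op \<nu> (g i) y) x)"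
    by (simp add: fun_eq_iff hilbert_commutator_def hilbert_lin_op[OF g i])
  then show ?thesis
    unfolding commutator_deriv_def
    using DERIV_diff[OF DERIV_mult[OF smooth_family_has_deriv[OF f i]
          smooth_family_has_deriv[OF smooth_family_flux[OF g] i]] hilbert_has_deriv[OF fg i]] by simp
qed

lemma smooth_family_commutator_deriv:
  assumes f: "smooth_family I f" and g: "smooth_family I g"
  shows "smooth_family I (\<lambda>i. commutator_deriv \<nu> (f i) (g i))"
  unfolding commutator_deriv_def
  by (rule smooth_family_diff[OF smooth_family_add[OF
        smooth_family_mult[OF smooth_family_deriv[OF f] smooth_family_flux[OF g]]
        smooth_family_mult[OF smooth_family_deriv[OF smooth_family_flux[OF g]] f]]
      smooth_family_hilbert[OF smooth_family_deriv[OF smooth_family_mult[OF f smooth_family_lin_op[OF g]]]]])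

lemma quad_op_eq:
  assumes "smooth_family I f" "i \<in> I"
  shows "quad_op \<nu> (f i) x = commutator_deriv \<nu> (f i) (f i) x"
  unfolding quad_op_def
  by (rule DERIV_imp_deriv[OF hilbert_commutator_has_deriv[OF assms(1) assms]])

lemma flux_add_cmult:
  assumes f: "smooth_family I f" and g: "smooth_family I g" and i: "i \<in> I"
  shows "flux \<nu> (\<lambda>x. f i x + c * g i x) = (\<lambda>x. flux \<nu> (f i) x + c * flux \<nu> (g i) x)"
proof -
  have d: "deriv (\<lambda>x. p i x + c * q i x) = (\<lambda>x. deriv (p i) x + c * deriv (q i) x)"
    if p: "smooth_family I p" and q: "smooth_family I q" for p q
    by (rule ext, rule DERIV_imp_deriv)
       (rule DERIV_add[OF smooth_family_has_deriv[OF p i] DERIV_cmult[OF smooth_family_has_deriv[OF q i]]])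
  note f1 = smooth_family_deriv[OF f] and g1 = smooth_family_deriv[OF g]
  note f2 = smooth_family_deriv[OF f1] and g2 = smooth_family_deriv[OF g1]
  show ?thesis
    unfolding fun_eq_iff flux_def d[OF f g] d[OF f1 g1] d[OF f2 g2] by (simp add: algebra_simps)
qed

lemma lin_op_add_cmult:
  assumes f: "smooth_family I f" and g: "smooth_family I g" and i: "i \<in> I"
  shows "lin_op \<nu> (\<lambda>x. f i x + c * g i x) = (\<lambda>x. lin_op \<nu> (f i) x + c * lin_op \<nu> (g i) x)"
proof -
  note ff = smooth_family_flux[OF f, of \<nu>] and gf = smooth_family_flux[OF g, of \<nu>]
  have "lin_op \<nu> (\<lambda>x. f i x + c * g i x) = (\<lambda>x. - hilbert (\<lambda>x. flux \<nu> (f i) x + c * flux \<nu> (g i) x) x)"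
    using lin_op_eq[OF smooth_family_add[OF f smooth_family_cmult[OF g]] i, of \<nu> c]
    unfolding flux_add_cmult[OF assms] .
  also have "\<dots> = (\<lambda>x. - hilbert (flux \<nu> (f i)) x - c * hilbert (flux \<nu> (g i)) x)"
    using hilbert_add[OF ff smooth_family_cmult[OF gf] i, of c] hilbert_cmult[OF gf i, of c] by simp
  finally show ?thesis
    by (simp add: lin_op_eq[OF f i] lin_op_eq[OF g i] fun_eq_iff)
qed

text \<open>Bilinear expansion of the commutator. The coefficients do not involve \<open>c\<close>,
  so they can be bounded before \<open>c\<close> tends to 0.\<close>

lemma quad_op_add_cmult:
  assumes f: "smooth_family I f" and g: "smooth_family I g" and i: "i \<in> I"
  shows "quad_op \<nu> (\<lambda>x. f i x + c * g i x) x = quad_op \<nu> (f i) x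
    + c * (commutator_deriv \<nu> (f i) (g i) x + commutator_deriv \<nu> (g i) (f i) x)
    + c\<^sup>2 * commutator_deriv \<nu> (g i) (g i) x"
proof -
  let ?K = "hilbert_commutator"
  note lf = smooth_family_lin_op[OF f, of \<nu>] and lg = smooth_family_lin_op[OF g, of \<nu>]
  note P = smooth_family_mult[OF f lf] smooth_family_mult[OF f lg] smooth_family_mult[OF g lf]
    smooth_family_mult[OF g lg]
  note S = smooth_family_add[OF P(1) smooth_family_cmult[OF P(2), of c]]
    smooth_family_add[OF P(3) smooth_family_cmult[OF P(4), of c]]
  have "?K (\<lambda>x. f i x + c * g i x) (lin_op \<nu> (\<lambda>x. f i x + c * g i x)) =
      (\<lambda>x. ?K (f i) (lin_op \<nu> (f i)) x + c * (?K (f i) (lin_op \<nu> (g i)) x + ?K (g i) (lin_op \<nu> (f i)) x)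
        + c\<^sup>2 * ?K (g i) (lin_op \<nu> (g i)) x)"
  proof
    fix x
    \<comment> \<open>The product is nested as sums and scalar multiples, the shape to which
      additivity and homogeneity of \<open>hilbert\<close> apply.\<close>
    have "(\<lambda>y. (f i y + c * g i y) * (lin_op \<nu> (f i) y + c * lin_op \<nu> (g i) y)) =
       (\<lambda>y. (f i y * lin_op \<nu> (f i) y + c * (f i y * lin_op \<nu> (g i) y))
          + c * (g i y * lin_op \<nu> (f i) y + c * (g i y * lin_op \<nu> (g i) y)))"
      by (auto simp: algebra_simps)
    then have "hilbert (\<lambda>y. (f i y + c * g i y) * (lin_op \<nu> (f i) y + c * lin_op \<nu> (g i) y)) x =
       (hilbert (\<lambda>y. f i y * lin_op \<nu> (f i) y) x + c * hilbert (\<lambda>y. f i y * lin_op \<nu> (g i) y) x)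
       + c * (hilbert (\<lambda>y. g i y * lin_op \<nu> (f i) y) x + c * hilbert (\<lambda>y. g i y * lin_op \<nu> (g i) y) x)"
      using hilbert_add[OF S(1) smooth_family_cmult[OF S(2), of c] i] hilbert_cmult[OF S(2) i, of c]
        hilbert_add[OF P(1) smooth_family_cmult[OF P(2), of c] i] hilbert_cmult[OF P(2) i, of c]
        hilbert_add[OF P(3) smooth_family_cmult[OF P(4), of c] i] hilbert_cmult[OF P(4) i, of c]
      by simp
    moreover have "hilbert (\<lambda>x. lin_op \<nu> (f i) x + c * lin_op \<nu> (g i) x) x =
        hilbert (lin_op \<nu> (f i)) x + c * hilbert (lin_op \<nu> (g i)) x"
      using hilbert_add[OF lf smooth_family_cmult[OF lg, of c] i] hilbert_cmult[OF lg i, of c] by simp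
    ultimately show "?K (\<lambda>x. f i x + c * g i x) (lin_op \<nu> (\<lambda>x. f i x + c * g i x)) x =
      ?K (f i) (lin_op \<nu> (f i)) x + c * (?K (f i) (lin_op \<nu> (g i)) x + ?K (g i) (lin_op \<nu> (f i)) x)
        + c\<^sup>2 * ?K (g i) (lin_op \<nu> (g i)) x"
      unfolding lin_op_add_cmult[OF assms] hilbert_commutator_def
      by (simp only:) (simp add: algebra_simps power2_eq_square)
  qed
  then have "quad_op \<nu> (\<lambda>x. f i x + c * g i x) x = deriv (\<lambda>x. ?K (f i) (lin_op \<nu> (f i)) x
      + c * (?K (f i) (lin_op \<nu> (g i)) x + ?K (g i) (lin_op \<nu> (f i)) x)
      + c\<^sup>2 * ?K (g i) (lin_op \<nu> (g i)) x) x"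
    unfolding quad_op_def by simp
  also have "\<dots> = commutator_deriv \<nu> (f i) (f i) x
    + c * (commutator_deriv \<nu> (f i) (g i) x + commutator_deriv \<nu> (g i) (f i) x)
    + c\<^sup>2 * commutator_deriv \<nu> (g i) (g i) x"
    by (rule DERIV_imp_deriv)
       (intro DERIV_add DERIV_cmult hilbert_commutator_has_deriv[OF f f i] hilbert_commutator_has_deriv[OF f g i]
          hilbert_commutator_has_deriv[OF g f i] hilbert_commutator_has_deriv[OF g g i])
  finally show ?thesis
    by (simp add: quad_op_eq[OF f i])
qed

section \<open>Fourier modes on the half line\<close>

text \<open>The mean value inequality on intervals of length 1. A vanishing derivative does not make
  \<open>V\<close> converge, but its unit increments still tend to 0.\<close>

lemma has_vector_derivative_increment_tendsto_0:
  fixes V :: "real \<Rightarrow> complex"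
  assumes der: "\<And>y. y \<le> 0 \<Longrightarrow> (V has_vector_derivative V' y) (at y within {..0})"
    and lim: "(V' \<longlongrightarrow> 0) at_bot"
  shows "((\<lambda>y. V y - V (y - 1)) \<longlongrightarrow> 0) at_bot"
proof (rule tendstoI)
  fix e :: real assume "e > 0"
  then have "\<forall>\<^sub>F y in at_bot. dist (V' y) 0 < e / 2"
    by (intro tendstoD[OF lim]) simp
  then obtain N where N: "\<And>y. y \<le> N \<Longrightarrow> norm (V' y) < e / 2"
    by (auto simp: eventually_at_bot_linorder)
  have "dist (V y - V (y - 1)) 0 < e" if "y \<le> min N 0" for y
  proof -
    have "norm (V y - V (y - 1)) \<le> e / 2 * norm (y - (y - 1))"
    proof (rule differentiable_bound)
      show "convex {..min N 0}" by simp
      show "(V has_derivative (\<lambda>h. h *\<^sub>R V' z)) (at z within {..min N 0})" if "z \<in> {..min N 0}" for z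
        using der[of z] that unfolding has_vector_derivative_def
        by (auto intro: has_derivative_subset)
      show "onorm (\<lambda>h. h *\<^sub>R V' z) \<le> e / 2" if "z \<in> {..min N 0}" for z
      proof (rule onorm_le)
        fix h :: real
        show "norm (h *\<^sub>R V' z) \<le> e / 2 * norm h"
          using mult_left_mono[OF less_imp_le[OF N[of z]], of "\<bar>h\<bar>"] that by (simp add: mult.commute)
      qed
    qed (use that in auto)
    then show ?thesis using \<open>e > 0\<close> by simp
  qed
  then show "\<forall>\<^sub>F y in at_bot. dist (V y - V (y - 1)) 0 < e"
    unfolding eventually_at_bot_linorder by blast
qed

lemma tendsto_at_bot_shift:
  fixes f :: "real \<Rightarrow> 'a::topological_space"
  assumes "(f \<longlongrightarrow> l) at_bot"
  shows "((\<lambda>y. f (y - 1)) \<longlongrightarrow> l) at_bot"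
proof (rule filterlim_compose[OF assms])
  show "filterlim (\<lambda>y::real. y - 1) at_bot at_bot"
    unfolding filterlim_at_bot by (metis eventually_at_bot_linorder diff_le_eq add_increasing2 zero_le_one)
qed

lemma has_vector_derivative_const_on_atMost:
  fixes f :: "real \<Rightarrow> complex"
  assumes "\<And>y. y \<le> 0 \<Longrightarrow> (f has_vector_derivative 0) (at y within {..0})" "y \<le> 0"
  shows "f y = f 0"
proof -
  obtain c where "\<And>x. x \<in> {..0} \<Longrightarrow> f x = c"
    using has_vector_derivative_zero_constant[of "{..0::real}" f] assms(1) by auto
  then show ?thesis using assms(2) by simp
qed

text \<open>
  In both lemmas on the modes, \<open>a\<close> and \<open>b\<close> are the modes of \<open>\<phi>1\<close> and of \<open>h0 \<phi>0\<close>. The mode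
  \<open>u = a - b'\<close> of \<open>\<phi>1 - h0 \<partial>\<^sub>2 \<phi>0\<close> is not assumed to decay, since the hypotheses give no decay of
  \<open>\<partial>\<^sub>2 \<phi>0\<close>; instead the growing solution is excluded through the increments over unit intervals of
  an antiderivative of \<open>u\<close>.
\<close>

lemma half_line_mode_zero_frequency:
  fixes u u1 a b :: "real \<Rightarrow> complex"
  assumes u: "\<And>y. y \<le> 0 \<Longrightarrow> (u has_vector_derivative u1 y) (at y within {..0})"
    and u1: "\<And>y. y \<le> 0 \<Longrightarrow> (u1 has_vector_derivative 0) (at y within {..0})"
    and b: "\<And>y. y \<le> 0 \<Longrightarrow> (b has_vector_derivative a y - u y) (at y within {..0})"
    and lim: "(a \<longlongrightarrow> 0) at_bot" "(b \<longlongrightarrow> 0) at_bot"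
  shows "u1 0 = 0"
proof -
  define C where "C = u1 0"
  have u1C: "u1 y = C" if "y \<le> 0" for y
    unfolding C_def by (rule has_vector_derivative_const_on_atMost[OF u1 that])
  define D where "D = u 0"
  have const: "u y - of_real y * C = u 0 - of_real 0 * C" if "y \<le> 0" for y
  proof (rule has_vector_derivative_const_on_atMost[OF _ that, of "\<lambda>y. u y - of_real y * C"])
    fix y :: real assume "y \<le> 0"
    show "((\<lambda>y. u y - of_real y * C) has_vector_derivative 0) (at y within {..0})"
      by (rule has_vector_derivative_eq_rhs[OF has_vector_derivative_diff[OF u[OF \<open>y \<le> 0\<close>]
            has_vector_derivative_mult_left[OF has_vector_derivative_of_real[OF DERIV_ident]]]])
         (simp add: u1C[OF \<open>y \<le> 0\<close>])
  qed
  have uD: "u y = of_real y * C + D" if "y \<le> 0" for y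
    using const[OF that] by (simp add: D_def diff_eq_eq add.commute)
  \<comment> \<open>Since \<open>b' = a - u\<close> and \<open>u\<close> is affine, adding an
    antiderivative of \<open>u\<close> to \<open>b\<close> gives an antiderivative of
    \<open>a\<close>.\<close>
  define V where "V y = b y + (of_real (y\<^sup>2 / 2) * C + of_real y * D)" for y
  have "(V has_vector_derivative a y) (at y within {..0})" if "y \<le> 0" for y
  proof -
    have sq: "((\<lambda>y. y\<^sup>2 / 2) has_real_derivative y) (at y within {..0})"
      by (auto intro!: derivative_eq_intros)
    show ?thesis
      unfolding V_def
      by (rule has_vector_derivative_eq_rhs[OF has_vector_derivative_add[OF b[OF that]
            has_vector_derivative_add[OF has_vector_derivative_mult_left[OF has_vector_derivative_of_real[OF sq]]
              has_vector_derivative_mult_left[OF has_vector_derivative_of_real[OF DERIV_ident]]]]])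
         (simp add: uD[OF that])
  qed
  then have V: "((\<lambda>y. V y - V (y - 1)) \<longlongrightarrow> 0) at_bot"
    by (rule has_vector_derivative_increment_tendsto_0[OF _ lim(1)])
  define z where "z y = (V y - V (y - 1)) - (b y - b (y - 1))" for y
  have z: "(z \<longlongrightarrow> 0) at_bot"
    unfolding z_def using tendsto_diff[OF V tendsto_diff[OF lim(2) tendsto_at_bot_shift[OF lim(2)]]] by simp
  \<comment> \<open>\<open>z\<close> is the unit increment of the quadratic part of
    \<open>V\<close>; its own increment is the second difference of \<open>C y^2 / 2\<close>, namely
    \<open>C\<close>.\<close>
  have "z y - z (y - 1) = C" for y
    unfolding z_def V_def by (simp add: power2_eq_square field_simps)
  with tendsto_diff[OF z tendsto_at_bot_shift[OF z]] have "((\<lambda>y. C) \<longlongrightarrow> 0) (at_bot :: real filter)"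
    by simp
  then have "C = 0"
    by (simp add: tendsto_const_iff)
  then show ?thesis by (simp add: C_def)
qed

lemma half_line_mode_nonzero_frequency:
  fixes u u1 a b :: "real \<Rightarrow> complex"
  assumes \<kappa>: "\<kappa> > 0"
    and u: "\<And>y. y \<le> 0 \<Longrightarrow> (u has_vector_derivative u1 y) (at y within {..0})"
    and u1: "\<And>y. y \<le> 0 \<Longrightarrow> (u1 has_vector_derivative of_real (\<kappa>\<^sup>2) * u y) (at y within {..0})"
    and b: "\<And>y. y \<le> 0 \<Longrightarrow> (b has_vector_derivative a y - u y) (at y within {..0})"
    and lim: "(a \<longlongrightarrow> 0) at_bot" "(b \<longlongrightarrow> 0) at_bot"
  shows "u1 0 = of_real \<kappa> * u 0"
proof -
  \<comment> \<open>The second order equation factors: for \<open>s = \<kappa>\<close> and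
    \<open>s = - \<kappa>\<close> the quantity \<open>u1 + s u\<close> solves
    \<open>w' = s w\<close>, which the integrating factor \<open>exp (- s y)\<close>
    integrates.\<close>
  have exponential: "u1 y + of_real s * u y = (u1 0 + of_real s * u 0) * of_real (exp (s * y))"
    if "y \<le> 0" "s\<^sup>2 = \<kappa>\<^sup>2" for y s
  proof -
    let ?W = "\<lambda>y. (u1 y + of_real s * u y) * of_real (exp (- s * y))"
    have "?W y = ?W 0"
    proof (rule has_vector_derivative_const_on_atMost[OF _ that(1), of ?W])
      fix y :: real assume y: "y \<le> 0"
      have e: "((\<lambda>y. exp (- s * y)) has_real_derivative - s * exp (- s * y)) (at y within {..0})"
        by (auto intro!: derivative_eq_intros)
      have p: "of_real (\<kappa>\<^sup>2) = (of_real s * of_real s :: complex)"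
        unfolding that(2)[symmetric] by (simp add: power2_eq_square)
      show "(?W has_vector_derivative 0) (at y within {..0})"
        by (rule has_vector_derivative_eq_rhs[OF has_vector_derivative_mult[OF 
              has_vector_derivative_add[OF u1[OF y] has_vector_derivative_mult_right[OF u[OF y]]]
              has_vector_derivative_of_real[OF e]]])
           (simp only: p of_real_mult of_real_minus, simp add: algebra_simps)
    qed
    then have "?W y * of_real (exp (s * y)) = (u1 0 + of_real s * u 0) * of_real (exp (s * y))"
      by simp
    moreover have "of_real (exp (- s * y)) * of_real (exp (s * y)) = (1 :: complex)"
      by (simp flip: of_real_mult exp_add)
    ultimately show ?thesis
      by (simp only: mult.assoc) simp
  qed
  \<comment> \<open>\<open>C\<close> is the amplitude of the solution growing as \<open>y\<close>
    tends to minus infinity, \<open>D\<close> that of the decaying one; the claim is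
    \<open>C = 0\<close>.\<close>
  define C where "C = u1 0 + of_real (- \<kappa>) * u 0"
  define D where "D = u1 0 + of_real \<kappa> * u 0"
  have u1CD: "2 * u1 y = C * of_real (exp (- \<kappa> * y)) + D * of_real (exp (\<kappa> * y))" if "y \<le> 0" for y
    using exponential[OF that, of \<kappa>] exponential[OF that, of "- \<kappa>"]
    unfolding C_def[symmetric] D_def[symmetric] by (simp add: algebra_simps)
  \<comment> \<open>By the equation \<open>u1 / \<kappa>^2\<close> is an antiderivative of
    \<open>u\<close>, so \<open>V\<close> is one of \<open>a\<close>.\<close>
  define V where "V y = b y + u1 y / of_real (\<kappa>\<^sup>2)" for y
  have "(V has_vector_derivative a y) (at y within {..0})" if "y \<le> 0" for y
    unfolding V_def
    by (rule has_vector_derivative_eq_rhs[OF has_vector_derivative_add[OF b[OF that]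
          has_vector_derivative_divide[OF u1[OF that]]]]) (use \<kappa> in simp)
  then have V: "((\<lambda>y. V y - V (y - 1)) \<longlongrightarrow> 0) at_bot"
    by (rule has_vector_derivative_increment_tendsto_0[OF _ lim(1)])
  have "((\<lambda>y. 2 * of_real (\<kappa>\<^sup>2) * ((V y - V (y - 1)) - (b y - b (y - 1)))) \<longlongrightarrow> 0) at_bot"
    using tendsto_mult_left[OF tendsto_diff[OF V tendsto_diff[OF lim(2) tendsto_at_bot_shift[OF lim(2)]]],
        of "2 * of_real (\<kappa>\<^sup>2)"] by simp
  then have "((\<lambda>y. 2 * u1 y - 2 * u1 (y - 1)) \<longlongrightarrow> 0) at_bot"
    by (rule Lim_transform_eventually) (use \<kappa> in \<open>simp add: V_def field_simps\<close>)
  moreover have E: "((\<lambda>y. exp (\<kappa> * y)) \<longlongrightarrow> 0) at_bot"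
    by (rule filterlim_compose[OF exp_at_bot]) (use \<kappa> in \<open>simp add: filterlim_tendsto_pos_mult_at_bot[OF tendsto_const _ filterlim_ident]\<close>)
  have "((\<lambda>y. D * of_real (exp (\<kappa> * y)) - D * of_real (exp (\<kappa> * (y - 1)))) \<longlongrightarrow> D * of_real 0 - D * of_real 0) at_bot"
    by (intro tendsto_diff tendsto_mult tendsto_const tendsto_of_real E tendsto_at_bot_shift[OF E])
  ultimately have "((\<lambda>y. (2 * u1 y - 2 * u1 (y - 1)) - (D * of_real (exp (\<kappa> * y)) - D * of_real (exp (\<kappa> * (y - 1))))) 
      \<longlongrightarrow> 0 - (D * of_real 0 - D * of_real 0)) at_bot"
    by (rule tendsto_diff)
  moreover have "\<forall>\<^sub>F y in at_bot. (2 * u1 y - 2 * u1 (y - 1)) - (D * of_real (exp (\<kappa> * y)) - D * of_real (exp (\<kappa> * (y - 1))))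
      = C * of_real (exp (- \<kappa> * y) * (1 - exp \<kappa>))"
    using eventually_le_at_bot[of 0]
  proof eventually_elim
    case (elim y)
    have shift: "exp (- \<kappa> * (y - 1)) = exp (- \<kappa> * y) * exp \<kappa>"
      by (simp add: algebra_simps flip: exp_add)
    have "2 * u1 y = C * of_real (exp (- \<kappa> * y)) + D * of_real (exp (\<kappa> * y))"
      "2 * u1 (y - 1) = C * of_real (exp (- \<kappa> * (y - 1))) + D * of_real (exp (\<kappa> * (y - 1)))"
      using u1CD[of y] u1CD[of "y - 1"] elim by auto
    then show ?case
      by (simp only: shift) (simp add: right_diff_distrib)
  qed
  ultimately have "((\<lambda>y. C * of_real (exp (- \<kappa> * y) * (1 - exp \<kappa>))) \<longlongrightarrow> 0) at_bot"
    by (subst (asm) tendsto_cong) simp_all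
  \<comment> \<open>Multiplying by the decaying exponential leaves the constant
    \<open>C (1 - exp \<kappa>)\<close>, which must equal its limit 0.\<close>
  from tendsto_mult[OF this tendsto_of_real[OF E]] 
  have "((\<lambda>y. C * of_real (exp (- \<kappa> * y) * (1 - exp \<kappa>)) * of_real (exp (\<kappa> * y))) \<longlongrightarrow> 0) at_bot"
    by simp
  moreover have "C * of_real (exp (- \<kappa> * y) * (1 - exp \<kappa>)) * of_real (exp (\<kappa> * y)) = C * of_real (1 - exp \<kappa>)" for y
    by (simp add: exp_minus field_simps)
  ultimately have "((\<lambda>y. C * of_real (1 - exp \<kappa>)) \<longlongrightarrow> 0) (at_bot :: real filter)"
    by (simp only:)
  then have "C * of_real (1 - exp \<kappa>) = 0"
    by (simp only: tendsto_const_iff[OF trivial_limit_at_bot_linorder])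
  moreover have "complex_of_real (1 - exp \<kappa>) \<noteq> 0"
    unfolding of_real_eq_0_iff using \<kappa> by simp
  ultimately have "C = 0"
    by (simp only: mult_eq_0_iff) simp
  then show ?thesis by (simp add: C_def)
qed

section \<open>Smooth functions on the half cylinder and on the circle\<close>

lemma Ck_on_cong:
  assumes "\<And>x. x \<in> S \<Longrightarrow> f x = g x"
  shows "Ck_on n S f = Ck_on n S g"
proof (cases n)
  case 0
  then show ?thesis using continuous_on_cong[OF refl assms] by simp
next
  case (Suc m)
  have "(f has_derivative f') (at x within S) = (g has_derivative f') (at x within S)" if "x \<in> S" for x f'
    using has_derivative_transform[OF that, of f g] has_derivative_transform[OF that, of g f] assms by metis
  then show ?thesis using Suc by simp
qed

lemma smooth_on_continuous: "smooth_on S f \<Longrightarrow> continuous_on S f"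
  unfolding smooth_on_def by (metis Ck_on.simps(1))

lemma smooth_on_has_derivative:
  assumes "smooth_on S f" "x \<in> S"
  obtains f' where "(f has_derivative f') (at x within S)"
  using assms unfolding smooth_on_def by (metis Ck_on.simps(2))

text \<open>The derivative inside \<open>Ck_on\<close> is existential and may vary with the order.
  The second assumption fixes its value in direction \<open>v\<close> for every candidate, so all
  orders speak of the same \<open>g\<close>.\<close>

lemma smooth_on_directional_derivative:
  assumes "smooth_on S f"
    and "\<And>x f'. x \<in> S \<Longrightarrow> (f has_derivative f') (at x within S) \<Longrightarrow> f' v = g x"
  shows "smooth_on S g"
  unfolding smooth_on_def
proof
  fix n
  have "Ck_on (Suc n) S f" using assms(1) unfolding smooth_on_def by blast
  then obtain f' where f': "\<And>x. x \<in> S \<Longrightarrow> (f has_derivative f' x) (at x within S)" "Ck_on n S (\<lambda>x. f' x v)"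
    by auto
  have "f' x v = g x" if "x \<in> S" for x
    using assms(2)[OF that f'(1)[OF that]] .
  from Ck_on_cong[of S "\<lambda>x. f' x v" g, OF this] f'(2) show "Ck_on n S g"
    by (rule iffD1)
qed

lemma has_derivative_along_line:
  assumes "(f has_derivative f') (at p within S)" "\<And>y. y \<in> U \<Longrightarrow> p + (y - y0) *\<^sub>R v \<in> S"
  shows "((\<lambda>y. f (p + (y - y0) *\<^sub>R v)) has_vector_derivative f' v) (at y0 within U)"
proof -
  let ?c = "\<lambda>y. p + (y - y0) *\<^sub>R v"
  have "(?c has_derivative (\<lambda>h. h *\<^sub>R v)) (at y0 within U)"
    by (auto intro!: derivative_eq_intros)
  moreover have "(f has_derivative f') (at (?c y0) within ?c ` U)"
    using has_derivative_subset[OF assms(1), of "?c ` U"] assms(2) by auto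
  ultimately have "((\<lambda>y. f (?c y)) has_derivative (\<lambda>h. f' (h *\<^sub>R v))) (at y0 within U)"
    by (rule has_derivative_in_compose)
  then show ?thesis
    unfolding has_vector_derivative_def linear_scale[OF has_derivative_linear[OF assms(1)]] .
qed

text \<open>Makes the one-sided derivative in \<open>D2\<close> unique, also at
  \<open>x2 = 0\<close>.\<close>

lemma at_within_atMost_neq_bot:
  assumes "y \<le> (0::real)" shows "at y within {..0} \<noteq> bot"
proof
  assume "at y within {..0} = bot"
  moreover have "at y within {..<y} \<le> at y within {..0}"
    using assms by (intro at_le) auto
  ultimately have "at_left y = bot"
    by (simp add: bot_unique)
  then show False using trivial_limit_at_left_real by blast
qed

section \<open>Partial derivatives on the half cylinder\<close>

context
  fixes T :: real and \<phi> :: "real \<Rightarrow> real \<Rightarrow> real \<Rightarrow> real"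
  assumes smooth: "smooth_cylinder T \<phi>"
begin

lemma smooth_cylinder_lines:
  assumes "((\<lambda>(x1, x2, t). \<phi> x1 x2 t) has_derivative f') (at (x1, x2, t) within UNIV \<times> {..0} \<times> {0..T})"
    and "x2 \<le> 0" "t \<in> {0..T}"
  shows "((\<lambda>y. \<phi> y x2 t) has_real_derivative f' (1, 0, 0)) (at x1)"
    and "((\<lambda>y. \<phi> x1 y t) has_real_derivative f' (0, 1, 0)) (at x2 within {..0})"
  using has_derivative_along_line[OF assms(1), where U = UNIV and ?y0.0 = x1 and v = "(1, 0, 0)"]
    has_derivative_along_line[OF assms(1), where U = "{..0}" and ?y0.0 = x2 and v = "(0, 1, 0)"] assms(2,3)
  by (simp_all add: has_real_derivative_iff_has_vector_derivative)

lemma smooth_cylinder_eq_D: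
  assumes "((\<lambda>(x1, x2, t). \<phi> x1 x2 t) has_derivative f') (at (x1, x2, t) within UNIV \<times> {..0} \<times> {0..T})"
    and "x2 \<le> 0" "t \<in> {0..T}"
  shows "f' (1, 0, 0) = D1 \<phi> x1 x2 t" "f' (0, 1, 0) = D2 \<phi> x1 x2 t"
  using DERIV_imp_deriv[OF smooth_cylinder_lines(1)[OF assms]]
    vector_derivative_within[OF at_within_atMost_neq_bot[OF assms(2)]
      smooth_cylinder_lines(2)[OF assms, unfolded has_real_derivative_iff_has_vector_derivative]]
  unfolding D1_def D2_def by simp_all

lemma smooth_cylinder_has_derivative:
  assumes "x2 \<le> 0" "t \<in> {0..T}"
  shows "((\<lambda>y. \<phi> y x2 t) has_real_derivative D1 \<phi> x1 x2 t) (at x1)"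
    and "((\<lambda>y. \<phi> x1 y t) has_real_derivative D2 \<phi> x1 x2 t) (at x2 within {..0})"
proof -
  obtain f' where f': "((\<lambda>(x1, x2, t). \<phi> x1 x2 t) has_derivative f') (at (x1, x2, t) within UNIV \<times> {..0} \<times> {0..T})"
    using smooth_on_has_derivative[of "UNIV \<times> {..0} \<times> {0..T}" "\<lambda>(x1, x2, t). \<phi> x1 x2 t" "(x1, x2, t)"] smooth assms
    unfolding smooth_cylinder_def by auto
  show "((\<lambda>y. \<phi> y x2 t) has_real_derivative D1 \<phi> x1 x2 t) (at x1)"
    "((\<lambda>y. \<phi> x1 y t) has_real_derivative D2 \<phi> x1 x2 t) (at x2 within {..0})"
    using smooth_cylinder_lines[OF f' assms] smooth_cylinder_eq_D[OF f' assms] by auto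
qed

lemma smooth_cylinder_periodic: "x2 \<le> 0 \<Longrightarrow> t \<in> {0..T} \<Longrightarrow> periodic (\<lambda>x1. \<phi> x1 x2 t)"
  using smooth by (simp add: smooth_cylinder_def)

lemma smooth_cylinder_D1: "smooth_cylinder T (D1 \<phi>)"
  unfolding smooth_cylinder_def
proof (intro conjI allI impI ballI)
  fix x2 t assume "x2 \<le> (0::real)" "t \<in> {0..T}"
  then show "periodic (\<lambda>x1. D1 \<phi> x1 x2 t)"
    using periodic_derivative[OF smooth_cylinder_periodic smooth_cylinder_has_derivative(1)] by blast
next
  show "smooth_on (UNIV \<times> {..0} \<times> {0..T}) (\<lambda>(x1, x2, t). D1 \<phi> x1 x2 t)"
    by (rule smooth_on_directional_derivative[of _ "\<lambda>(x1, x2, t). \<phi> x1 x2 t" "(1, 0, 0)"])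
       (use smooth smooth_cylinder_eq_D(1) in \<open>auto simp: smooth_cylinder_def\<close>)
qed

lemma smooth_cylinder_D2: "smooth_cylinder T (D2 \<phi>)"
  unfolding smooth_cylinder_def
proof (intro conjI allI impI ballI)
  fix x2 t assume a: "x2 \<le> (0::real)" "t \<in> {0..T}"
  show "periodic (\<lambda>x1. D2 \<phi> x1 x2 t)"
    unfolding periodic_def
  proof
    fix x1
    \<comment> \<open>The vertical lines through \<open>x1\<close> and \<open>x1 + 2 * pi\<close>
      carry the same values on \<open>{..0}\<close>, so the derivative along one also serves the
      other.\<close>
    have "((\<lambda>y. \<phi> x1 y t) has_vector_derivative D2 \<phi> (x1 + 2 * pi) x2 t) (at x2 within {..0})"
    proof (rule has_vector_derivative_transform)
      show "((\<lambda>y. \<phi> (x1 + 2 * pi) y t) has_vector_derivative D2 \<phi> (x1 + 2 * pi) x2 t) (at x2 within {..0})"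
        using smooth_cylinder_has_derivative(2)[OF a] by (simp add: has_real_derivative_iff_has_vector_derivative)
      show "\<phi> x1 y t = \<phi> (x1 + 2 * pi) y t" if "y \<in> {..0}" for y
        using smooth_cylinder_periodic[of y t] that a by (simp add: periodic_def)
    qed (use a in simp)
    then show "D2 \<phi> (x1 + 2 * pi) x2 t = D2 \<phi> x1 x2 t"
      using vector_derivative_within[OF at_within_atMost_neq_bot[OF a(1)]] unfolding D2_def by metis
  qed
next
  show "smooth_on (UNIV \<times> {..0} \<times> {0..T}) (\<lambda>(x1, x2, t). D2 \<phi> x1 x2 t)"
    by (rule smooth_on_directional_derivative[of _ "\<lambda>(x1, x2, t). \<phi> x1 x2 t" "(0, 1, 0)"])
       (use smooth smooth_cylinder_eq_D(2) in \<open>auto simp: smooth_cylinder_def\<close>)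
qed

lemma smooth_cylinder_continuous:
  assumes "t \<in> {0..T}"
  shows "continuous_on (UNIV \<times> {..0}) (\<lambda>(x1, x2). \<phi> x1 x2 t)"
proof -
  have "continuous_on (UNIV \<times> {..0} \<times> {0..T}) (\<lambda>(x1, x2, t). \<phi> x1 x2 t)"
    using smooth smooth_on_continuous unfolding smooth_cylinder_def by blast
  then have "continuous_on (UNIV \<times> {..0}) (\<lambda>p. (\<lambda>(x1, x2, t). \<phi> x1 x2 t) (fst p, snd p, t))"
    by (rule continuous_on_compose2) (use assms in \<open>auto intro!: continuous_intros\<close>)
  then show ?thesis by (simp add: case_prod_unfold)
qed

lemma smooth_cylinder_continuous_slice:
  assumes "x2 \<le> 0" "t \<in> {0..T}"
  shows "continuous_on S (\<lambda>x1. \<phi> x1 x2 t)"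
  by (rule DERIV_continuous_on[OF has_field_derivative_at_within[OF smooth_cylinder_has_derivative(1)[OF assms]]])

end

text \<open>Positive length of the time interval makes the derivative within it unique, including
  the one-sided ones at its ends.\<close>

lemma at_within_time_interval_neq_bot:
  assumes "0 < (T::real)" "t \<in> {0..T}" shows "at t within {0..T} \<noteq> bot"
  using assms by (auto simp: trivial_limit_within intro!: islimpt_closure_open[where s="{0 <..< T}"])

context
  fixes T :: real and h :: "real \<Rightarrow> real \<Rightarrow> real"
  assumes smooth: "smooth_circle T h" and T: "T > 0"
begin

lemma smooth_circle_lines:
  assumes "((\<lambda>(x, t). h x t) has_derivative f') (at (x, t) within UNIV \<times> {0..T})" and "t \<in> {0..T}"
  shows "((\<lambda>y. h y t) has_real_derivative f' (1, 0)) (at x)"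
    and "((\<lambda>s. h x s) has_vector_derivative f' (0, 1)) (at t within {0..T})"
  using has_derivative_along_line[OF assms(1), where U = UNIV and ?y0.0 = x and v = "(1, 0)"]
    has_derivative_along_line[OF assms(1), where U = "{0..T}" and ?y0.0 = t and v = "(0, 1)"] assms(2)
  by (simp_all add: has_real_derivative_iff_has_vector_derivative)

lemma smooth_circle_has_derivative:
  assumes "t \<in> {0..T}"
  shows "((\<lambda>y. h y t) has_real_derivative dx h x t) (at x)"
    and "((\<lambda>s. h x s) has_vector_derivative dt T h x t) (at t within {0..T})"
proof -
  obtain f' where f': "((\<lambda>(x, t). h x t) has_derivative f') (at (x, t) within UNIV \<times> {0..T})"
    using smooth_on_has_derivative[of "UNIV \<times> {0..T}" "\<lambda>(x, t). h x t" "(x, t)"] smooth assms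
    unfolding smooth_circle_def by auto
  note l = smooth_circle_lines[OF f' assms]
  show "((\<lambda>y. h y t) has_real_derivative dx h x t) (at x)"
    using l(1) DERIV_imp_deriv[OF l(1)] by (simp add: dx_def)
  show "((\<lambda>s. h x s) has_vector_derivative dt T h x t) (at t within {0..T})"
    using l(2) vector_derivative_within[OF at_within_time_interval_neq_bot[OF T assms] l(2)] by (simp add: dt_def)
qed

lemma smooth_circle_dx: "smooth_circle T (dx h)"
  unfolding smooth_circle_def
proof (intro conjI ballI)
  fix t assume t: "t \<in> {0..T}"
  have "periodic (\<lambda>x. h x t)"
    using smooth t by (simp add: smooth_circle_def)
  then show "periodic (\<lambda>x. dx h x t)"
    by (rule periodic_derivative[OF _ smooth_circle_has_derivative(1)[OF t]])
next
  show "smooth_on (UNIV \<times> {0..T}) (\<lambda>(x, t). dx h x t)"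
  proof (rule smooth_on_directional_derivative[of _ "\<lambda>(x, t). h x t" "(1, 0)"])
    show "smooth_on (UNIV \<times> {0..T}) (\<lambda>(x, t). h x t)"
      using smooth by (simp add: smooth_circle_def)
    show "f' (1, 0) = (case p of (x, t) \<Rightarrow> dx h x t)" 
      if "p \<in> UNIV \<times> {0..T}" "((\<lambda>(x, t). h x t) has_derivative f') (at p within UNIV \<times> {0..T})" for p f'
      using that smooth_circle_lines(1)[of f' "fst p" "snd p"] by (auto simp: dx_def DERIV_imp_deriv)
  qed
qed

text \<open>Compactness of one period times the closed time interval; this is the origin of all
  uniformity in time.\<close>

lemma smooth_circle_bounded: "\<exists>M. \<forall>t\<in>{0..T}. \<forall>x. \<bar>h x t\<bar> \<le> M"
proof -
  have "continuous_on (UNIV \<times> {0..T}) (\<lambda>(x, t). h x t)"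
    using smooth smooth_on_continuous unfolding smooth_circle_def by blast
  then have "compact ((\<lambda>(x, t). h x t) ` ({-pi..pi} \<times> {0..T}))"
    by (intro compact_continuous_image compact_Times) (auto intro: continuous_on_subset)
  then have "bounded ((\<lambda>(x, t). h x t) ` ({-pi..pi} \<times> {0..T}))"
    by (rule compact_imp_bounded)
  then obtain M where M: "\<forall>p\<in>{-pi..pi} \<times> {0..T}. \<bar>case p of (x, t) \<Rightarrow> h x t\<bar> \<le> M"
    unfolding bounded_iff by auto
  have "\<bar>h x t\<bar> \<le> M" if t: "t \<in> {0..T}" for x t
  proof -
    have "periodic (\<lambda>x. h x t)"
      using smooth t by (simp add: smooth_circle_def)
    then obtain y where "y \<in> {-pi..pi}" "h x t = h y t"
      by (rule periodic_reduce[of "\<lambda>x. h x t" x])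
    then show ?thesis using M t by auto
  qed
  then show ?thesis by blast
qed

end

lemma smooth_family_smooth_circle:
  assumes "smooth_circle T h" and T: "T > 0"
  shows "smooth_family {0..T} (\<lambda>t x. h x t)"
proof -
  have "smooth_circle T h \<Longrightarrow> bounded_Ck n {0..T} (\<lambda>t x. h x t)" for n
  proof (induction n arbitrary: h)
    case 0
    then show ?case using smooth_circle_bounded[OF _ T] by simp
  next
    case (Suc n)
    show ?case
      using smooth_circle_has_derivative(1)[OF Suc.prems T]
      by (intro bounded_Ck_SucI[OF smooth_circle_bounded[OF Suc.prems T] _ Suc.IH[OF smooth_circle_dx[OF Suc.prems T]]]) blast
  qed
  moreover have "periodic (\<lambda>x. h x t)" if "t \<in> {0..T}" for t
    using assms(1) that by (simp add: smooth_circle_def)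
  ultimately show ?thesis
    using assms(1) by (simp add: smooth_family_def)
qed

section \<open>The boundary relation\<close>

text \<open>The weight \<open>p\<close> depends on \<open>x\<close> alone, so differentiation in
  depth passes it by. It will be 1, or the profile or one of its derivatives.\<close>

lemma smooth_cylinder_fourier_coeff_has_derivative:
  assumes \<phi>: "smooth_cylinder T \<phi>" and t: "t \<in> {0..T}" and p: "continuous_on UNIV p" and "y \<le> 0"
  shows "((\<lambda>y. fourier_coeff (\<lambda>x. p x * \<phi> x y t) k) has_vector_derivative
    fourier_coeff (\<lambda>x. p x * D2 \<phi> x y t) k) (at y within {..0})"
proof (rule fourier_coeff_leibniz[where F' = "\<lambda>x y. p x * D2 \<phi> x y t"])
  fix x y :: real assume y: "y \<in> {..0}"
  then have y': "y \<le> 0" by simp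
  show "((\<lambda>y. p x * \<phi> x y t) has_real_derivative p x * D2 \<phi> x y t) (at y within {..0})"
    by (rule DERIV_cmult[OF smooth_cylinder_has_derivative(2)[OF \<phi> y' t]])
  show "continuous_on UNIV (\<lambda>x. p x * \<phi> x y t)"
    by (rule continuous_on_mult[OF p smooth_cylinder_continuous_slice[OF \<phi> y' t]])
next
  have "continuous_on (UNIV \<times> {..0::real}) (\<lambda>z. p (fst z))"
    by (rule continuous_on_compose2[OF p continuous_on_fst[OF continuous_on_id]]) simp
  from continuous_on_mult[OF this smooth_cylinder_continuous[OF smooth_cylinder_D2[OF \<phi>] t]]
  show "continuous_on (UNIV \<times> {..0}) (\<lambda>(x, y). p x * D2 \<phi> x y t)"
    by (simp add: case_prod_unfold)
qed (use \<open>y \<le> 0\<close> in auto)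

lemma decays_fourier_coeff_tendsto:
  assumes \<phi>: "smooth_cylinder T \<phi>" "decays T \<phi>" and t: "t \<in> {0..T}"
    and p: "continuous_on UNIV p" "\<And>x. \<bar>p x\<bar> \<le> M"
  shows "((\<lambda>y. fourier_coeff (\<lambda>x. p x * \<phi> x y t) k) \<longlongrightarrow> 0) at_bot"
proof -
  have "M \<ge> 0" using p(2)[of 0] by simp
  have lim: "uniform_limit UNIV (\<lambda>y x. \<phi> x y t) (\<lambda>x. 0) at_bot"
    using \<phi>(2) t by (simp add: decays_def)
  have "((\<lambda>y. fourier_coeff (\<lambda>x. p x * \<phi> x y t) k) \<longlongrightarrow> fourier_coeff (\<lambda>x. 0) k) at_bot"
  proof (rule fourier_coeff_tendsto)
    show "uniform_limit {-pi..pi} (\<lambda>y x. p x * \<phi> x y t) (\<lambda>x. 0) at_bot"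
    proof (rule uniform_limitI)
      fix e :: real assume "e > 0"
      \<comment> \<open>Dividing by \<open>M + 1\<close> covers the case
        \<open>M = 0\<close>.\<close>
      then have "\<forall>\<^sub>F y in at_bot. \<forall>x\<in>UNIV. dist (\<phi> x y t) 0 < e / (M + 1)"
        using \<open>M \<ge> 0\<close> by (intro uniform_limitD[OF lim]) simp
      then show "\<forall>\<^sub>F y in at_bot. \<forall>x\<in>{-pi..pi}. dist (p x * \<phi> x y t) 0 < e"
      proof eventually_elim
        case (elim y)
        show ?case
        proof
          fix x
          have *: "\<bar>\<phi> x y t\<bar> < e / (M + 1)" using elim by (simp add: dist_real_def)
          have "\<bar>p x\<bar> * \<bar>\<phi> x y t\<bar> \<le> M * \<bar>\<phi> x y t\<bar>"
            by (rule mult_right_mono[OF p(2)]) simp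
          also have "\<dots> \<le> (M + 1) * \<bar>\<phi> x y t\<bar>"
            by (rule mult_right_mono) simp_all
          also have "\<dots> < (M + 1) * (e / (M + 1))"
            using * \<open>M \<ge> 0\<close> by (intro mult_strict_left_mono) simp_all
          also have "\<dots> = e" using \<open>M \<ge> 0\<close> by simp
          finally show "dist (p x * \<phi> x y t) 0 < e"
            by (simp add: dist_real_def abs_mult)
        qed
      qed
    qed
    show "\<forall>\<^sub>F y in at_bot. continuous_on {-pi..pi} (\<lambda>x. p x * \<phi> x y t)"
      using eventually_le_at_bot[of 0]
    proof eventually_elim
      case (elim y)
      show ?case
        by (rule continuous_on_mult[OF continuous_on_subset[OF p(1)] smooth_cylinder_continuous_slice[OF \<phi>(1) elim t]]) simp
    qed
  qed simp
  moreover have "fourier_coeff (\<lambda>x. 0) k = 0" by (simp add: fourier_coeff_def)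
  ultimately show ?thesis by simp
qed

text \<open>Integration by parts with a weight: the \<open>x1\<close>-derivative leaves
  \<open>\<phi>\<close> and falls on the exponential and on \<open>p\<close>.\<close>

lemma fourier_coeff_mult_D1:
  assumes \<phi>: "smooth_cylinder T \<phi>" and y: "y \<le> 0" and t: "t \<in> {0..T}"
    and p: "periodic p" "\<And>x. (p has_real_derivative p' x) (at x)" "continuous_on UNIV p'"
  shows "fourier_coeff (\<lambda>x. p x * D1 \<phi> x y t) k =
    \<i> * of_int k * fourier_coeff (\<lambda>x. p x * \<phi> x y t) k - fourier_coeff (\<lambda>x. p' x * \<phi> x y t) k"
proof -
  have cont: "continuous_on S p" for S
    by (rule DERIV_continuous_on[OF has_field_derivative_at_within[OF p(2)]])
  have c1: "continuous_on {-pi..pi} (\<lambda>x. p' x * \<phi> x y t)"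
    by (rule continuous_on_mult[OF continuous_on_subset[OF p(3)] smooth_cylinder_continuous_slice[OF \<phi> y t]]) simp
  have c2: "continuous_on {-pi..pi} (\<lambda>x. p x * D1 \<phi> x y t)"
    by (rule continuous_on_mult[OF cont smooth_cylinder_continuous_slice[OF smooth_cylinder_D1[OF \<phi>] y t]])
  have "fourier_coeff (\<lambda>x. p' x * \<phi> x y t + p x * D1 \<phi> x y t) k = \<i> * of_int k * fourier_coeff (\<lambda>x. p x * \<phi> x y t) k"
  proof (rule fourier_coeff_deriv)
    show "periodic (\<lambda>x. p x * \<phi> x y t)"
      using p(1) smooth_cylinder_periodic[OF \<phi> y t] by (simp add: periodic_def)
    show "((\<lambda>x. p x * \<phi> x y t) has_real_derivative p' x * \<phi> x y t + p x * D1 \<phi> x y t) (at x)" for x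
      using DERIV_mult[OF p(2) smooth_cylinder_has_derivative(1)[OF \<phi> y t]] by (simp add: mult.commute)
    show "continuous_on {-pi..pi} (\<lambda>x. p' x * \<phi> x y t + p x * D1 \<phi> x y t)"
      by (rule continuous_on_add[OF c1 c2])
  qed
  then show ?thesis
    using fourier_coeff_add[OF c1 c2, of k] by (simp add: eq_diff_eq add.commute)
qed

lemma fourier_coeff_mult_D1_D1:
  assumes \<phi>: "smooth_cylinder T \<phi>" and y: "y \<le> 0" and t: "t \<in> {0..T}"
    and p: "periodic p" "\<And>x. (p has_real_derivative p' x) (at x)" "\<And>x. (p' has_real_derivative p'' x) (at x)"
      "continuous_on UNIV p''"
  shows "fourier_coeff (\<lambda>x. p x * D1 (D1 \<phi>) x y t) k =
    - of_int (k\<^sup>2) * fourier_coeff (\<lambda>x. p x * \<phi> x y t) k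
    - 2 * \<i> * of_int k * fourier_coeff (\<lambda>x. p' x * \<phi> x y t) k + fourier_coeff (\<lambda>x. p'' x * \<phi> x y t) k"
proof -
  have cont: "continuous_on UNIV p'"
    by (rule DERIV_continuous_on[OF has_field_derivative_at_within[OF p(3)]])
  note per = periodic_derivative[OF p(1,2)]
  show ?thesis
    unfolding fourier_coeff_mult_D1[OF smooth_cylinder_D1[OF \<phi>] y t p(1,2) cont]
      fourier_coeff_mult_D1[OF \<phi> y t p(1,2) cont] fourier_coeff_mult_D1[OF \<phi> y t per p(3,4)]
    by (simp add: algebra_simps power2_eq_square)
qed

text \<open>
  The Dirichlet-to-Neumann relation for \<open>\<psi> - h \<partial>\<^sub>2 \<phi>\<close>; for \<open>h = 0\<close> it is the one for \<open>\<psi>\<close>.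
\<close>

lemma boundary_mode_relation:
  assumes \<phi>: "smooth_cylinder T \<phi>" "decays T \<phi>" and \<psi>: "smooth_cylinder T \<psi>" "decays T \<psi>"
    and t: "t \<in> {0..T}"
    and h: "periodic h" "\<And>x. (h has_real_derivative h1 x) (at x)" "\<And>x. (h1 has_real_derivative h2 x) (at x)"
      "continuous_on UNIV h2" "\<And>x. \<bar>h x\<bar> \<le> M"
    and bulk_\<phi>: "\<And>x y. y \<le> 0 \<Longrightarrow> D2 (D2 \<phi>) x y t = - D1 (D1 \<phi>) x y t"
    and bulk_\<psi>: "\<And>x y. y \<le> 0 \<Longrightarrow>
      D2 (D2 \<psi>) x y t = h2 x * D2 \<phi> x y t + 2 * h1 x * D1 (D2 \<phi>) x y t - D1 (D1 \<psi>) x y t"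
  shows "fourier_coeff (\<lambda>x. D2 \<psi> x 0 t) k - fourier_coeff (\<lambda>x. h x * D2 (D2 \<phi>) x 0 t) k =
    of_int \<bar>k\<bar> * (fourier_coeff (\<lambda>x. \<psi> x 0 t) k - fourier_coeff (\<lambda>x. h x * D2 \<phi> x 0 t) k)"
proof -
  note \<phi>2 = smooth_cylinder_D2[OF \<phi>(1)] and \<psi>2 = smooth_cylinder_D2[OF \<psi>(1)]
  have conth: "continuous_on UNIV h"
    by (rule DERIV_continuous_on[OF has_field_derivative_at_within[OF h(2)]])
  have conth1: "continuous_on UNIV h1"
    by (rule DERIV_continuous_on[OF has_field_derivative_at_within[OF h(3)]])
  note cont1 = continuous_on_const[of UNIV "1::real"]
  \<comment> \<open>The explicit factor 1 lets the lemmas on weighted modes apply to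
    \<open>\<psi>\<close> itself.\<close>
  define a where "a y = fourier_coeff (\<lambda>x. 1 * \<psi> x y t) k" for y
  define b where "b y = fourier_coeff (\<lambda>x. h x * \<phi> x y t) k" for y
  define u where "u y = a y - fourier_coeff (\<lambda>x. h x * D2 \<phi> x y t) k" for y
  define u1 where "u1 y = fourier_coeff (\<lambda>x. 1 * D2 \<psi> x y t) k - fourier_coeff (\<lambda>x. h x * D2 (D2 \<phi>) x y t) k" for y
  have u: "(u has_vector_derivative u1 y) (at y within {..0})" if "y \<le> 0" for y
    unfolding u_def u1_def a_def
    by (rule has_vector_derivative_diff[OF
          smooth_cylinder_fourier_coeff_has_derivative[OF \<psi>(1) t cont1 that]
          smooth_cylinder_fourier_coeff_has_derivative[OF \<phi>2 t conth that]])
  \<comment> \<open>The second \<open>x2\<close>-derivative is traded for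
    \<open>x1\<close>-derivatives, which are then integrated away. Only weighted modes of
    \<open>\<phi>\<close> remain, and differentiating them in \<open>y\<close> produces nothing
    beyond \<open>D2 \<phi>\<close>.\<close>
  have hD2D2: "fourier_coeff (\<lambda>x. h x * D2 (D2 \<phi>) x y t) k =
      of_int (k\<^sup>2) * fourier_coeff (\<lambda>x. h x * \<phi> x y t) k
      + 2 * \<i> * of_int k * fourier_coeff (\<lambda>x. h1 x * \<phi> x y t) k - fourier_coeff (\<lambda>x. h2 x * \<phi> x y t) k"
    if "y \<le> 0" for y
    using fourier_coeff_mult_D1_D1[OF \<phi>(1) that t h(1-4), of k]
      fourier_coeff_minus[of "\<lambda>x. h x * D1 (D1 \<phi>) x y t" k]
    by (simp add: bulk_\<phi>[OF that])
  have D2D2: "fourier_coeff (\<lambda>x. 1 * D2 (D2 \<psi>) x y t) k =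
      of_int (k\<^sup>2) * a y + 2 * \<i> * of_int k * fourier_coeff (\<lambda>x. h1 x * D2 \<phi> x y t) k
      - fourier_coeff (\<lambda>x. h2 x * D2 \<phi> x y t) k" if y: "y \<le> 0" for y
  proof -
    have c: "continuous_on {-pi..pi} (\<lambda>x. h2 x * D2 \<phi> x y t)"
      "continuous_on {-pi..pi} (\<lambda>x. h1 x * D1 (D2 \<phi>) x y t)"
      "continuous_on {-pi..pi} (\<lambda>x. 1 * D1 (D1 \<psi>) x y t)"
      by (intro continuous_on_mult continuous_on_const continuous_on_subset[OF h(4) subset_UNIV]
          continuous_on_subset[OF conth1 subset_UNIV] smooth_cylinder_continuous_slice[OF _ y t] \<phi>2
          smooth_cylinder_D1 \<psi>(1))+
    have "fourier_coeff (\<lambda>x. 1 * D2 (D2 \<psi>) x y t) k =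
      fourier_coeff (\<lambda>x. (h2 x * D2 \<phi> x y t + 2 * (h1 x * D1 (D2 \<phi>) x y t)) - 1 * D1 (D1 \<psi>) x y t) k"
      by (simp add: bulk_\<psi>[OF y] mult.assoc)
    also have "\<dots> = fourier_coeff (\<lambda>x. h2 x * D2 \<phi> x y t) k + 2 * fourier_coeff (\<lambda>x. h1 x * D1 (D2 \<phi>) x y t) k
        - fourier_coeff (\<lambda>x. 1 * D1 (D1 \<psi>) x y t) k"
      using fourier_coeff_diff[OF continuous_on_add[OF c(1) continuous_on_mult[OF continuous_on_const c(2), of 2]] c(3), of k]
        fourier_coeff_add[OF c(1) continuous_on_mult[OF continuous_on_const c(2), of 2], of k]
        fourier_coeff_cmult[of 2 "\<lambda>x. h1 x * D1 (D2 \<phi>) x y t" k] by simp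
    also have "fourier_coeff (\<lambda>x. h1 x * D1 (D2 \<phi>) x y t) k = 
        \<i> * of_int k * fourier_coeff (\<lambda>x. h1 x * D2 \<phi> x y t) k - fourier_coeff (\<lambda>x. h2 x * D2 \<phi> x y t) k"
      by (rule fourier_coeff_mult_D1[OF \<phi>2 y t periodic_derivative[OF h(1,2)] h(3,4)])
    also have "fourier_coeff (\<lambda>x. 1 * D1 (D1 \<psi>) x y t) k = - of_int (k\<^sup>2) * a y"
      unfolding a_def
      by (subst fourier_coeff_mult_D1_D1[OF \<psi>(1) y t, of "\<lambda>x. 1" "\<lambda>x. 0" "\<lambda>x. 0"])
         (simp_all add: periodic_def fourier_coeff_const)
    finally show ?thesis by (simp add: algebra_simps)
  qed
  \<comment> \<open>The terms weighted by \<open>h1\<close> and \<open>h2\<close> agree in both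
    contributions and cancel: this is the harmonicity of \<open>\<psi> - h D2 \<phi>\<close>, read
    on one mode.\<close>
  have u1: "(u1 has_vector_derivative of_int (k\<^sup>2) * u y) (at y within {..0})" if y: "y \<le> 0" for y
  proof (rule has_vector_derivative_transform)
    show "y \<in> {..0}" using y by simp
    show "u1 y = fourier_coeff (\<lambda>x. 1 * D2 \<psi> x y t) k - (of_int (k\<^sup>2) * fourier_coeff (\<lambda>x. h x * \<phi> x y t) k
      + 2 * \<i> * of_int k * fourier_coeff (\<lambda>x. h1 x * \<phi> x y t) k - fourier_coeff (\<lambda>x. h2 x * \<phi> x y t) k)"
      if "y \<in> {..0}" for y
      unfolding u1_def using hD2D2[of y] that by simp
    show "((\<lambda>y. fourier_coeff (\<lambda>x. 1 * D2 \<psi> x y t) k - (of_int (k\<^sup>2) * fourier_coeff (\<lambda>x. h x * \<phi> x y t) k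
      + 2 * \<i> * of_int k * fourier_coeff (\<lambda>x. h1 x * \<phi> x y t) k - fourier_coeff (\<lambda>x. h2 x * \<phi> x y t) k))
      has_vector_derivative of_int (k\<^sup>2) * u y) (at y within {..0})"
      by (rule has_vector_derivative_eq_rhs[OF has_vector_derivative_diff[OF
            smooth_cylinder_fourier_coeff_has_derivative[OF \<psi>2 t cont1 y]
            has_vector_derivative_diff[OF has_vector_derivative_add[OF
              has_vector_derivative_mult_right[OF smooth_cylinder_fourier_coeff_has_derivative[OF \<phi>(1) t conth y]]
              has_vector_derivative_mult_right[OF smooth_cylinder_fourier_coeff_has_derivative[OF \<phi>(1) t conth1 y]]]
              smooth_cylinder_fourier_coeff_has_derivative[OF \<phi>(1) t h(4) y]]]])
         (simp only: D2D2[OF y] u_def, simp add: algebra_simps)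
  qed
  have b: "(b has_vector_derivative a y - u y) (at y within {..0})" if "y \<le> 0" for y
    unfolding b_def u_def
    using smooth_cylinder_fourier_coeff_has_derivative[OF \<phi>(1) t conth that, of k] by simp
  have a0: "(a \<longlongrightarrow> 0) at_bot"
    unfolding a_def by (rule decays_fourier_coeff_tendsto[OF \<psi> t cont1, of 1]) simp
  have b0: "(b \<longlongrightarrow> 0) at_bot"
    unfolding b_def by (rule decays_fourier_coeff_tendsto[OF \<phi> t conth h(5)])
  have "u1 0 = of_int \<bar>k\<bar> * u 0"
  proof (cases "k = 0")
    case True
    then show ?thesis
      using half_line_mode_zero_frequency[OF u _ b a0 b0] u1 by simp
  next
    case False
    have "of_real (\<bar>real_of_int k\<bar>\<^sup>2) = (of_int (k\<^sup>2) :: complex)"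
      by simp
    then have "u1 0 = of_real \<bar>real_of_int k\<bar> * u 0"
      using half_line_mode_nonzero_frequency[OF _ u _ b a0 b0, of "\<bar>real_of_int k\<bar>"] u1 False by simp
    then show ?thesis by (simp flip: of_int_abs)
  qed
  then show ?thesis by (simp add: u_def u1_def a_def)
qed

text \<open>
  The bulk equations are only given for negative \<open>x2\<close>; this extends them to the boundary.
\<close>

lemma eq_at_boundary:
  fixes f g :: "real \<Rightarrow> real"
  assumes "continuous_on {..0} f" "continuous_on {..0} g" "\<And>y. y < 0 \<Longrightarrow> f y = g y" "y \<le> 0"
  shows "f y = g y"
proof -
  have "f y - g y = 0"
    by (rule continuous_constant_on_closure[of "{..<0}" "\<lambda>y. f y - g y"])
       (use assms in \<open>auto simp: closure_lessThan intro: continuous_on_diff\<close>)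
  then show ?thesis by simp
qed

section \<open>The asymptotic model\<close>

lemma smooth_cylinder_continuous_vertical:
  assumes "smooth_cylinder T \<phi>" "t \<in> {0..T}"
  shows "continuous_on {..0} (\<lambda>y. \<phi> x y t)"
  using smooth_cylinder_has_derivative(2)[OF assms(1) _ assms(2)]
  by (intro DERIV_continuous_on) auto

lemma dx_flux:
  assumes "smooth_circle T h" "T > 0" "t \<in> {0..T}"
  shows "dx (\<lambda>y s. h y s - \<nu> * dx (dx h) y s) x t = flux \<nu> (\<lambda>y. h y t) x"
proof -
  note f = smooth_family_smooth_circle[OF assms(1,2)]
  note f2 = smooth_family_deriv[OF smooth_family_deriv[OF f]]
  have "dx (\<lambda>y s. h y s - \<nu> * dx (dx h) y s) x t = deriv (\<lambda>y. h y t - \<nu> * deriv (deriv (\<lambda>x. h x t)) y) x"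
    by (simp add: dx_def)
  also have "\<dots> = flux \<nu> (\<lambda>y. h y t) x"
    unfolding flux_def
    by (rule DERIV_imp_deriv, rule DERIV_diff[OF smooth_family_has_deriv[OF f assms(3)]
          DERIV_cmult[OF smooth_family_has_deriv[OF f2 assms(3)]]])
  finally show ?thesis .
qed

lemma leading_order_velocity:
  assumes T: "T > 0" and h: "smooth_circle T h" and \<phi>: "smooth_cylinder T \<phi>" "decays T \<phi>" and t: "t \<in> {0..T}"
    and bulk: "\<And>x y. y \<le> 0 \<Longrightarrow> D2 (D2 \<phi>) x y t = - D1 (D1 \<phi>) x y t"
    and flux: "\<And>x. D2 \<phi> x 0 t = flux \<nu> (\<lambda>y. h y t) x"
  shows "D1 \<phi> x 0 t = lin_op \<nu> (\<lambda>y. h y t) x"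
proof -
  note f = smooth_family_smooth_circle[OF h T]
  note L = smooth_family_lin_op[OF f, of \<nu>]
  have "(\<lambda>x. D1 \<phi> x 0 t) = lin_op \<nu> (\<lambda>y. h y t)"
  proof (rule fourier_coeff_inject)
    show "continuous_on UNIV (\<lambda>x. D1 \<phi> x 0 t)"
      by (rule smooth_cylinder_continuous_slice[OF smooth_cylinder_D1[OF \<phi>(1)] order_refl t])
    show "periodic (\<lambda>x. D1 \<phi> x 0 t)"
      by (rule smooth_cylinder_periodic[OF smooth_cylinder_D1[OF \<phi>(1)] order_refl t])
    show "continuous_on UNIV (lin_op \<nu> (\<lambda>y. h y t))" "periodic (lin_op \<nu> (\<lambda>y. h y t))"
      using smooth_family_continuous[OF L t] smooth_family_periodic[OF L t] by auto
    fix k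
    have D1: "fourier_coeff (\<lambda>x. D1 \<phi> x 0 t) k = \<i> * of_int k * fourier_coeff (\<lambda>x. \<phi> x 0 t) k"
      by (rule fourier_coeff_deriv[OF smooth_cylinder_periodic[OF \<phi>(1) order_refl t]
            smooth_cylinder_has_derivative(1)[OF \<phi>(1) order_refl t]
            smooth_cylinder_continuous_slice[OF smooth_cylinder_D1[OF \<phi>(1)] order_refl t]])
    have zero: "fourier_coeff (\<lambda>x. 0) k = 0" by (simp add: fourier_coeff_def)
    have "fourier_coeff (\<lambda>x. D2 \<phi> x 0 t) k - fourier_coeff (\<lambda>x. 0 * D2 (D2 \<phi>) x 0 t) k =
      of_int \<bar>k\<bar> * (fourier_coeff (\<lambda>x. \<phi> x 0 t) k - fourier_coeff (\<lambda>x. 0 * D2 \<phi> x 0 t) k)"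
      \<comment> \<open>\<open>\<phi>\<close> plays both roles and the profile is zero, so the
        second bulk equation reduces to the first.\<close>
      by (rule boundary_mode_relation[OF \<phi> \<phi> t, of _ "\<lambda>x. 0" "\<lambda>x. 0" 0]) (auto simp: periodic_def bulk)
    then have "fourier_coeff (flux \<nu> (\<lambda>y. h y t)) k = of_int \<bar>k\<bar> * fourier_coeff (\<lambda>x. \<phi> x 0 t) k"
      by (simp add: zero flux)
    then have "fourier_coeff (lin_op \<nu> (\<lambda>y. h y t)) k = - (- \<i> * of_int (sgn k) * (of_int \<bar>k\<bar> * fourier_coeff (\<lambda>x. \<phi> x 0 t) k))"
      unfolding lin_op_eq[OF f t] fourier_coeff_minus smooth_family_fourier_hilbert[OF smooth_family_flux[OF f] t] by simp
    then show "fourier_coeff (\<lambda>x. D1 \<phi> x 0 t) k = fourier_coeff (lin_op \<nu> (\<lambda>y. h y t)) k"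
      unfolding D1 by (cases k "0::int" rule: linorder_cases) simp_all
  qed
  then show ?thesis by (rule fun_cong)
qed

lemma first_order_velocity:
  assumes T: "T > 0" and h0: "smooth_circle T h0" and h1: "smooth_circle T h1"
    and \<phi>: "smooth_cylinder T \<phi>" "decays T \<phi>" and \<psi>: "smooth_cylinder T \<psi>" "decays T \<psi>" and t: "t \<in> {0..T}"
    and bulk_\<phi>: "\<And>x y. y \<le> 0 \<Longrightarrow> D2 (D2 \<phi>) x y t = - D1 (D1 \<phi>) x y t"
    and flux_\<phi>: "\<And>x. D2 \<phi> x 0 t = flux \<nu> (\<lambda>y. h0 y t) x"
    and bulk_\<psi>: "\<And>x y. y \<le> 0 \<Longrightarrow>
      D2 (D2 \<psi>) x y t = dx (dx h0) x t * D2 \<phi> x y t + 2 * dx h0 x t * D1 (D2 \<phi>) x y t - D1 (D1 \<psi>) x y t"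
    and flux_\<psi>: "\<And>x. D2 \<psi> x 0 t = flux \<nu> (\<lambda>y. h1 y t) x + dx h0 x t * D1 \<phi> x 0 t"
  shows "D1 \<psi> x 0 t = lin_op \<nu> (\<lambda>y. h1 y t) x + quad_op \<nu> (\<lambda>y. h0 y t) x"
proof -
  note f0 = smooth_family_smooth_circle[OF h0 T] and f1 = smooth_family_smooth_circle[OF h1 T]
  note L0 = smooth_family_lin_op[OF f0, of \<nu>] and L1 = smooth_family_lin_op[OF f1, of \<nu>]
  note G0 = smooth_family_flux[OF f0, of \<nu>] and G1 = smooth_family_flux[OF f1, of \<nu>]
  note hG = smooth_family_mult[OF f0 G0] and hL = smooth_family_mult[OF f0 L0]
  note Q = smooth_family_commutator_deriv[OF f0 f0, of \<nu>]
  note R = smooth_family_add[OF L1 Q]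
  let ?h = "\<lambda>x. h0 x t" and ?w = "lin_op \<nu> (\<lambda>x. h0 x t)" and ?g = "flux \<nu> (\<lambda>x. h0 x t)"
  have w: "(\<lambda>x. D1 \<phi> x 0 t) = ?w"
    using leading_order_velocity[OF T h0 \<phi> t bulk_\<phi> flux_\<phi>] by (simp add: fun_eq_iff)
  have "(\<lambda>x. D1 \<psi> x 0 t) = (\<lambda>x. lin_op \<nu> (\<lambda>y. h1 y t) x + commutator_deriv \<nu> ?h ?h x)"
  proof (rule fourier_coeff_inject)
    show "continuous_on UNIV (\<lambda>x. D1 \<psi> x 0 t)"
      by (rule smooth_cylinder_continuous_slice[OF smooth_cylinder_D1[OF \<psi>(1)] order_refl t])
    show "periodic (\<lambda>x. D1 \<psi> x 0 t)"
      by (rule smooth_cylinder_periodic[OF smooth_cylinder_D1[OF \<psi>(1)] order_refl t])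
    show "continuous_on UNIV (\<lambda>x. lin_op \<nu> (\<lambda>y. h1 y t) x + commutator_deriv \<nu> ?h ?h x)"
      by (rule smooth_family_continuous[OF R t])
    show "periodic (\<lambda>x. lin_op \<nu> (\<lambda>y. h1 y t) x + commutator_deriv \<nu> ?h ?h x)"
      by (rule smooth_family_periodic[OF R t])
    fix k
    let ?s = "\<i> * of_int (sgn k) :: complex"
    have "fourier_coeff (lin_op \<nu> (\<lambda>y. h1 y t)) k = ?s * fourier_coeff (flux \<nu> (\<lambda>y. h1 y t)) k"
      unfolding lin_op_eq[OF f1 t] fourier_coeff_minus smooth_family_fourier_hilbert[OF G1 t] by simp
    moreover have "fourier_coeff (commutator_deriv \<nu> ?h ?h) k =
        \<i> * of_int k * fourier_coeff (\<lambda>x. ?h x * ?g x) k + ?s * (\<i> * of_int k * fourier_coeff (\<lambda>x. ?h x * ?w x) k)"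
    proof -
      have d: "deriv (\<lambda>x. ?h x * ?g x) = (\<lambda>x. deriv ?h x * ?g x + deriv ?g x * ?h x)"
        by (rule ext, rule DERIV_imp_deriv, rule DERIV_mult[OF smooth_family_has_deriv[OF f0 t] smooth_family_has_deriv[OF G0 t]])
      \<comment> \<open>The first two terms of \<open>commutator_deriv\<close> form the derivative
        of one product, so each part gains a plain factor \<open>\<i> k\<close>.\<close>
      have "commutator_deriv \<nu> ?h ?h = (\<lambda>x. deriv (\<lambda>x. ?h x * ?g x) x - hilbert (deriv (\<lambda>x. ?h x * ?w x)) x)"
        unfolding d by (simp add: commutator_deriv_def fun_eq_iff)
      then have "fourier_coeff (commutator_deriv \<nu> ?h ?h) k =
          fourier_coeff (deriv (\<lambda>x. ?h x * ?g x)) k - fourier_coeff (hilbert (deriv (\<lambda>x. ?h x * ?w x))) k"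
        using fourier_coeff_diff[OF smooth_family_continuous[OF smooth_family_deriv[OF hG] t]
            smooth_family_continuous[OF smooth_family_hilbert[OF smooth_family_deriv[OF hL]] t], of k] by simp
      then show ?thesis
        unfolding smooth_family_fourier_hilbert[OF smooth_family_deriv[OF hL] t]
          smooth_family_fourier_deriv[OF hL t] smooth_family_fourier_deriv[OF hG t] by simp
    qed
    moreover have "fourier_coeff (\<lambda>x. lin_op \<nu> (\<lambda>y. h1 y t) x + commutator_deriv \<nu> ?h ?h x) k =
       fourier_coeff (lin_op \<nu> (\<lambda>y. h1 y t)) k + fourier_coeff (commutator_deriv \<nu> ?h ?h) k"
      by (rule fourier_coeff_add[OF smooth_family_continuous[OF L1 t] smooth_family_continuous[OF Q t]])
    ultimately have rhs: "fourier_coeff (\<lambda>x. lin_op \<nu> (\<lambda>y. h1 y t) x + commutator_deriv \<nu> ?h ?h x) k =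
        ?s * (fourier_coeff (flux \<nu> (\<lambda>y. h1 y t)) k + \<i> * of_int k * fourier_coeff (\<lambda>x. ?h x * ?w x) k)
        + \<i> * of_int k * fourier_coeff (\<lambda>x. ?h x * ?g x) k"
      by (simp add: algebra_simps)
    obtain M where M: "\<And>s x. s \<in> {0..T} \<Longrightarrow> \<bar>h0 x s\<bar> \<le> M"
      using smooth_family_bound[OF f0] by blast
    note f0' = smooth_family_deriv[OF f0]
    note f0'' = smooth_family_deriv[OF f0']
    have dxx: "dx h0 x t = deriv ?h x" "dx (dx h0) x t = deriv (deriv ?h) x" for x
      by (simp_all add: dx_def)
    have mode: "fourier_coeff (\<lambda>x. D2 \<psi> x 0 t) k - fourier_coeff (\<lambda>x. ?h x * D2 (D2 \<phi>) x 0 t) k =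
      of_int \<bar>k\<bar> * (fourier_coeff (\<lambda>x. \<psi> x 0 t) k - fourier_coeff (\<lambda>x. ?h x * D2 \<phi> x 0 t) k)"
      by (rule boundary_mode_relation[OF \<phi> \<psi> t smooth_family_periodic[OF f0 t]
            smooth_family_has_deriv[OF f0 t] smooth_family_has_deriv[OF f0' t]
            smooth_family_continuous[OF f0'' t] M[OF t] bulk_\<phi> bulk_\<psi>[unfolded dxx]])
    \<comment> \<open>On the boundary \<open>- D2 (D2 \<phi>) = D1 (D1 \<phi>)\<close> is the
      derivative of the velocity \<open>?w\<close>. Together with the term
      \<open>dx h0 * D1 \<phi>\<close> of the flux condition it completes the derivative of
      \<open>?h * ?w\<close>.\<close>
    have source: "fourier_coeff (\<lambda>x. D2 \<psi> x 0 t) k - fourier_coeff (\<lambda>x. ?h x * D2 (D2 \<phi>) x 0 t) k =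
      fourier_coeff (flux \<nu> (\<lambda>y. h1 y t)) k + \<i> * of_int k * fourier_coeff (\<lambda>x. ?h x * ?w x) k"
    proof -
      have d: "deriv (\<lambda>x. ?h x * ?w x) = (\<lambda>x. deriv ?h x * ?w x + deriv ?w x * ?h x)"
        by (rule ext, rule DERIV_imp_deriv, rule DERIV_mult[OF smooth_family_has_deriv[OF f0 t] smooth_family_has_deriv[OF L0 t]])
      have "D1 (D1 \<phi>) x 0 t = deriv ?w x" for x
        unfolding D1_def[of "D1 \<phi>"] w ..
      then have eq: "(\<lambda>x. D2 \<psi> x 0 t - ?h x * D2 (D2 \<phi>) x 0 t) = (\<lambda>x. flux \<nu> (\<lambda>y. h1 y t) x + deriv (\<lambda>x. ?h x * ?w x) x)"
        using w unfolding d by (simp add: fun_eq_iff flux_\<psi> bulk_\<phi> dxx)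
      have c: "continuous_on {-pi..pi} (\<lambda>x. D2 \<psi> x 0 t)" "continuous_on {-pi..pi} (\<lambda>x. ?h x * D2 (D2 \<phi>) x 0 t)"
        by (intro continuous_on_mult smooth_family_continuous[OF f0 t] 
            smooth_cylinder_continuous_slice[OF _ order_refl t] smooth_cylinder_D2 \<phi>(1) \<psi>(1))+
      have "fourier_coeff (\<lambda>x. D2 \<psi> x 0 t) k - fourier_coeff (\<lambda>x. ?h x * D2 (D2 \<phi>) x 0 t) k =
          fourier_coeff (\<lambda>x. flux \<nu> (\<lambda>y. h1 y t) x + deriv (\<lambda>x. ?h x * ?w x) x) k"
        unfolding eq[symmetric] by (rule fourier_coeff_diff[OF c, symmetric])
      also have "\<dots> = fourier_coeff (flux \<nu> (\<lambda>y. h1 y t)) k + fourier_coeff (deriv (\<lambda>x. ?h x * ?w x)) k"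
        by (rule fourier_coeff_add[OF smooth_family_continuous[OF G1 t] smooth_family_continuous[OF smooth_family_deriv[OF hL] t]])
      finally show ?thesis
        unfolding smooth_family_fourier_deriv[OF hL t] .
    qed
    have cancel: "?s * (of_int \<bar>k\<bar> * z) = \<i> * of_int k * z" for z
      by (cases k "0::int" rule: linorder_cases) simp_all
    \<comment> \<open>The mode relation contributes \<open>- \<i> k\<close> times the mode of
      \<open>?h * D2 \<phi>\<close>. Since \<open>D2 \<phi> = ?g\<close> at the boundary, this
      cancels the product term of the commutator and leaves the derivative of
      \<open>\<psi>\<close>.\<close>
    have "fourier_coeff (\<lambda>x. lin_op \<nu> (\<lambda>y. h1 y t) x + commutator_deriv \<nu> ?h ?h x) k =
        \<i> * of_int k * fourier_coeff (\<lambda>x. \<psi> x 0 t) k"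
      unfolding rhs source[symmetric] mode cancel by (simp add: flux_\<phi> right_diff_distrib)
    also have "\<dots> = fourier_coeff (\<lambda>x. D1 \<psi> x 0 t) k"
      by (rule fourier_coeff_deriv[OF smooth_cylinder_periodic[OF \<psi>(1) order_refl t]
            smooth_cylinder_has_derivative(1)[OF \<psi>(1) order_refl t]
            smooth_cylinder_continuous_slice[OF smooth_cylinder_D1[OF \<psi>(1)] order_refl t], symmetric])
    finally show "fourier_coeff (\<lambda>x. D1 \<psi> x 0 t) k =
        fourier_coeff (\<lambda>x. lin_op \<nu> (\<lambda>y. h1 y t) x + commutator_deriv \<nu> ?h ?h x) k" ..
  qed
  then show ?thesis
    by (simp add: fun_eq_iff quad_op_eq[OF f0 t])
qed

theorem mainTheorem1:
  fixes \<nu> T :: real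
    and h0 h1 :: "real \<Rightarrow> real \<Rightarrow> real"
    and \<phi>0 \<phi>1 :: "real \<Rightarrow> real \<Rightarrow> real \<Rightarrow> real"
  assumes nu: "\<nu> \<ge> 0" and T: "T > 0"
    and smooth_h: "smooth_circle T h0" "smooth_circle T h1"
    and smooth_phi: "smooth_cylinder T \<phi>0" "smooth_cylinder T \<phi>1"
    and decay: "decays T \<phi>0" "decays T \<phi>1"
    and bulk0: "\<And>x1 x2 t. x2 < 0 \<Longrightarrow> t \<in> {0..T} \<Longrightarrow> laplacian \<phi>0 x1 x2 t = 0"
    and flux0: "\<And>x t. t \<in> {0..T} \<Longrightarrow>
      D2 \<phi>0 x 0 t = dx (\<lambda>y s. h0 y s - \<nu> * dx (dx h0) y s) x t"
    and kin0: "\<And>x t. t \<in> {0..T} \<Longrightarrow> dt T h0 x t = D1 \<phi>0 x 0 t"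
    and bulk1: "\<And>x1 x2 t. x2 < 0 \<Longrightarrow> t \<in> {0..T} \<Longrightarrow>
      laplacian \<phi>1 x1 x2 t =
        dx (dx h0) x1 t * D2 \<phi>0 x1 x2 t + 2 * dx h0 x1 t * D1 (D2 \<phi>0) x1 x2 t"
    and flux1: "\<And>x t. t \<in> {0..T} \<Longrightarrow>
      D2 \<phi>1 x 0 t =
        dx (\<lambda>y s. h1 y s - \<nu> * dx (dx h1) y s) x t + dx h0 x t * D1 \<phi>0 x 0 t"
    and kin1: "\<And>x t. t \<in> {0..T} \<Longrightarrow> dt T h1 x t = D1 \<phi>1 x 0 t"
  shows "(\<forall>x. \<forall>t\<in>{0..T}. dt T h0 x t = lin_op \<nu> (\<lambda>y. h0 y t) x) \<and>
    (\<forall>x. \<forall>t\<in>{0..T}.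
      dt T h1 x t = lin_op \<nu> (\<lambda>y. h1 y t) x + quad_op \<nu> (\<lambda>y. h0 y t) x) \<and>
    (\<exists>C. \<forall>\<^sub>F \<sigma> in at_right 0. \<forall>x. \<forall>t\<in>{0..T}.
      \<bar>dt T (\<lambda>y s. h0 y s + \<sigma> * h1 y s) x t
         - (lin_op \<nu> (\<lambda>y. h0 y t + \<sigma> * h1 y t) x
            + \<sigma> * quad_op \<nu> (\<lambda>y. h0 y t + \<sigma> * h1 y t) x)\<bar> \<le> C * \<sigma>\<^sup>2)"
proof -
  note f0 = smooth_family_smooth_circle[OF smooth_h(1) T] and f1 = smooth_family_smooth_circle[OF smooth_h(2) T]
  note cyl0 = smooth_phi(1) smooth_cylinder_D1[OF smooth_phi(1)] smooth_cylinder_D2[OF smooth_phi(1)]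
  note cyl1 = smooth_phi(2) smooth_cylinder_D1[OF smooth_phi(2)] smooth_cylinder_D2[OF smooth_phi(2)]
  note vert = smooth_cylinder_continuous_vertical
  have b0: "D2 (D2 \<phi>0) x y t = - D1 (D1 \<phi>0) x y t" if t: "t \<in> {0..T}" and y: "y \<le> 0" for x y t
  proof (rule eq_at_boundary[of "\<lambda>y. D2 (D2 \<phi>0) x y t" "\<lambda>y. - D1 (D1 \<phi>0) x y t", OF _ _ _ y])
    show "continuous_on {..0} (\<lambda>y. D2 (D2 \<phi>0) x y t)"
      by (rule vert[OF smooth_cylinder_D2[OF cyl0(3)] t])
    show "continuous_on {..0} (\<lambda>y. - D1 (D1 \<phi>0) x y t)"
      by (rule continuous_on_minus[OF vert[OF smooth_cylinder_D1[OF cyl0(2)] t]])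
    show "D2 (D2 \<phi>0) x y t = - D1 (D1 \<phi>0) x y t" if "y < 0" for y
      using bulk0[OF that t, of x] by (simp add: laplacian_def)
  qed
  have b1: "D2 (D2 \<phi>1) x y t =
      dx (dx h0) x t * D2 \<phi>0 x y t + 2 * dx h0 x t * D1 (D2 \<phi>0) x y t - D1 (D1 \<phi>1) x y t"
    if t: "t \<in> {0..T}" and y: "y \<le> 0" for x y t
  proof (rule eq_at_boundary[of "\<lambda>y. D2 (D2 \<phi>1) x y t" 
        "\<lambda>y. dx (dx h0) x t * D2 \<phi>0 x y t + 2 * dx h0 x t * D1 (D2 \<phi>0) x y t - D1 (D1 \<phi>1) x y t", OF _ _ _ y])
    show "continuous_on {..0} (\<lambda>y. D2 (D2 \<phi>1) x y t)"
      by (rule vert[OF smooth_cylinder_D2[OF cyl1(3)] t])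
    show "continuous_on {..0} (\<lambda>y. dx (dx h0) x t * D2 \<phi>0 x y t + 2 * dx h0 x t * D1 (D2 \<phi>0) x y t - D1 (D1 \<phi>1) x y t)"
      by (intro continuous_on_diff continuous_on_add continuous_on_mult continuous_on_const
          vert[OF cyl0(3) t] vert[OF smooth_cylinder_D1[OF cyl0(3)] t] vert[OF smooth_cylinder_D1[OF cyl1(2)] t])
    show "D2 (D2 \<phi>1) x y t =
      dx (dx h0) x t * D2 \<phi>0 x y t + 2 * dx h0 x t * D1 (D2 \<phi>0) x y t - D1 (D1 \<phi>1) x y t" if "y < 0" for y
      using bulk1[OF that t, of x] by (simp add: laplacian_def)
  qed
  have fl0: "D2 \<phi>0 x 0 t = flux \<nu> (\<lambda>y. h0 y t) x" if "t \<in> {0..T}" for x t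
    using flux0[OF that] dx_flux[OF smooth_h(1) T that] by simp
  have fl1: "D2 \<phi>1 x 0 t = flux \<nu> (\<lambda>y. h1 y t) x + dx h0 x t * D1 \<phi>0 x 0 t" if "t \<in> {0..T}" for x t
    using flux1[OF that] dx_flux[OF smooth_h(2) T that] by simp
  have evol0: "dt T h0 x t = lin_op \<nu> (\<lambda>y. h0 y t) x" if t: "t \<in> {0..T}" for x t
    unfolding kin0[OF t]
    by (rule leading_order_velocity[OF T smooth_h(1) smooth_phi(1) decay(1) t b0[OF t] fl0[OF t]])
  have evol1: "dt T h1 x t = lin_op \<nu> (\<lambda>y. h1 y t) x + quad_op \<nu> (\<lambda>y. h0 y t) x" if t: "t \<in> {0..T}" for x t
    unfolding kin1[OF t]
    by (rule first_order_velocity[OF T smooth_h smooth_phi(1) decay(1) smooth_phi(2) decay(2) t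
          b0[OF t] fl0[OF t] b1[OF t] fl1[OF t]])
  let ?B = "\<lambda>u v t. commutator_deriv \<nu> (\<lambda>x. u x t) (\<lambda>x. v x t)"
  obtain M1 where M1: "\<And>t x. t \<in> {0..T} \<Longrightarrow> \<bar>?B h0 h1 t x + ?B h1 h0 t x\<bar> \<le> M1"
    using smooth_family_bound[OF smooth_family_add[OF smooth_family_commutator_deriv[OF f0 f1]
          smooth_family_commutator_deriv[OF f1 f0]], of \<nu> \<nu>] by blast
  obtain M2 where M2: "\<And>t x. t \<in> {0..T} \<Longrightarrow> \<bar>?B h1 h1 t x\<bar> \<le> M2"
    using smooth_family_bound[OF smooth_family_commutator_deriv[OF f1 f1], of \<nu>] by blast
  have "\<bar>dt T (\<lambda>y s. h0 y s + \<sigma> * h1 y s) x t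
         - (lin_op \<nu> (\<lambda>y. h0 y t + \<sigma> * h1 y t) x
            + \<sigma> * quad_op \<nu> (\<lambda>y. h0 y t + \<sigma> * h1 y t) x)\<bar> \<le> (M1 + M2) * \<sigma>\<^sup>2"
    if \<sigma>: "0 < \<sigma>" "\<sigma> < 1" and t: "t \<in> {0..T}" for \<sigma> x t
  proof -
    have "((\<lambda>s. h0 x s + \<sigma> * h1 x s) has_vector_derivative dt T h0 x t + \<sigma> * dt T h1 x t) (at t within {0..T})"
      by (rule has_vector_derivative_add[OF smooth_circle_has_derivative(2)[OF smooth_h(1) T t]
            has_vector_derivative_mult_right[OF smooth_circle_has_derivative(2)[OF smooth_h(2) T t]]])
    then have "dt T (\<lambda>y s. h0 y s + \<sigma> * h1 y s) x t = dt T h0 x t + \<sigma> * dt T h1 x t"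
      unfolding dt_def[of T "\<lambda>y s. h0 y s + \<sigma> * h1 y s"]
      by (rule vector_derivative_within[OF at_within_time_interval_neq_bot[OF T t]])
    \<comment> \<open>The two evolution equations cancel the linear terms and
      \<open>\<sigma>\<close> times \<open>quad_op\<close> of \<open>h0\<close>. What remains is the
      part of \<open>quad_op\<close> with at least one factor \<open>h1\<close>, already multiplied
      by \<open>\<sigma>\<close>.\<close>
    then have eq: "dt T (\<lambda>y s. h0 y s + \<sigma> * h1 y s) x t
         - (lin_op \<nu> (\<lambda>y. h0 y t + \<sigma> * h1 y t) x + \<sigma> * quad_op \<nu> (\<lambda>y. h0 y t + \<sigma> * h1 y t) x)
      = - (\<sigma>\<^sup>2 * ((?B h0 h1 t x + ?B h1 h0 t x) + \<sigma> * ?B h1 h1 t x))"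
      unfolding lin_op_add_cmult[OF f0 f1 t] quad_op_add_cmult[OF f0 f1 t] evol0[OF t] evol1[OF t]
      by (simp add: algebra_simps power2_eq_square)
    \<comment> \<open>For \<open>\<sigma> < 1\<close> the cubic term is absorbed into the quadratic
      bound, whence the constant \<open>M1 + M2\<close>.\<close>
    have "\<bar>\<sigma> * ?B h1 h1 t x\<bar> \<le> 1 * M2"
      unfolding abs_mult using \<sigma> by (intro mult_mono M2[OF t]) simp_all
    then have "\<bar>(?B h0 h1 t x + ?B h1 h0 t x) + \<sigma> * ?B h1 h1 t x\<bar> \<le> M1 + M2"
      using M1[OF t, of x] by linarith
    from mult_left_mono[OF this zero_le_power2[of \<sigma>]] show ?thesis
      unfolding eq abs_minus_cancel abs_mult[of "\<sigma>\<^sup>2"] by (simp add: mult.commute)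
  qed
  then have "\<forall>\<^sub>F \<sigma> in at_right 0. \<forall>x. \<forall>t\<in>{0..T}.
      \<bar>dt T (\<lambda>y s. h0 y s + \<sigma> * h1 y s) x t
         - (lin_op \<nu> (\<lambda>y. h0 y t + \<sigma> * h1 y t) x
            + \<sigma> * quad_op \<nu> (\<lambda>y. h0 y t + \<sigma> * h1 y t) x)\<bar> \<le> (M1 + M2) * \<sigma>\<^sup>2"
    unfolding eventually_at_right_field by (intro exI[of _ 1]) simp
  then show ?thesis
    using evol0 evol1 by blast
qed

end
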